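(* Let $X$ be a stable white noise with parameters $(\alpha,\beta,\sigma,\mu)$ and $X_0=\int_0^1X(t)\,dt$. Then for every $m(\cdot):\mathbb N\to\mathbb N$ with $\lim_{n\to\infty} m(n)/n^{1/\alpha}=\infty$, $$\lim_{n\to\infty}\sup_{m\ge m(n)}\left|\frac{\mathcal H_{m,n}(X)}{n}-\log\frac{m}{n^{1/\alpha}}-h(X_0)\right|=0,$$ where $h(X_0)$ is the differential entropy of the continuous random variable $X_0$.
   Context: A stable white noise with parameters $\alpha\in(0,2]$, $\beta\in[-1,1]$, $\sigma>0$, $\mu\in\mathbb R$ is the generalized random process $X$ on $\mathcal S'(\mathbb R)$ with $\mathbb E[e^{j\langle X,\varphi\rangle}]=\exp(\int_{\mathbb R}f(\varphi(t))dt)$, $f(\omega)=j\omega\mu-\sigma^\alpha|\omega|^\alpha(1-j\beta\,\mathrm{sgn}(\omega)\Phi(\omega))$, $\Phi(\omega)=\tan\frac{\pi\alpha}2$ if $\alpha\ne1$ and $\Phi(\omega)=-\frac2\pi\log|\omega|$ if $\alpha=1$. For $n\in\mathbb N$, $X_1^{(n)}=\int_0^{1/n}X(t)\,dt$ (increment of the associated Lévy process) and $X_0=\int_0^1X(t)dt$. $[x]_m=\frac1m\lfloor\frac12+mx\rfloor$, $\mathcal H_{m,n}(X)=n\,H([X_1^{(n)}]_m)$ with $H$ discrete entropy (natural log). *)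

theory Defs
  imports "HOL-Probability.Probability"
begin

definition stable_Phi :: "real \<Rightarrow> real \<Rightarrow> real" where
  "stable_Phi \<alpha> \<omega> = (if \<alpha> \<noteq> 1 then tan (pi * \<alpha> / 2) else - (2 / pi) * ln \<bar>\<omega>\<bar>)"

definition stable_exponent :: "real \<Rightarrow> real \<Rightarrow> real \<Rightarrow> real \<Rightarrow> real \<Rightarrow> complex" where
  "stable_exponent \<alpha> \<beta> \<sigma> \<mu> \<omega> =
     \<i> * complex_of_real (\<omega> * \<mu>)
     - complex_of_real ((\<sigma> powr \<alpha>) * (\<bar>\<omega>\<bar> powr \<alpha>))
       * (1 - \<i> * complex_of_real (\<beta> * sgn \<omega> * stable_Phi \<alpha> \<omega>))"

definition quant_index :: "nat \<Rightarrow> real \<Rightarrow> int" where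
  "quant_index m x = \<lfloor>1/2 + real m * x\<rfloor>"

definition quant :: "nat \<Rightarrow> real \<Rightarrow> real" where
  "quant m x = real_of_int (quant_index m x) / real m"

definition quant_entropy :: "real measure \<Rightarrow> nat \<Rightarrow> ereal" where
  "quant_entropy P m = enn2ereal
     (\<integral>\<^sup>+ v. ennreal (let p = measure P {x \<in> space P. quant m x = v} in - p * ln p)
        \<partial>count_space (quant m ` UNIV))"

definition diff_entropy :: "real measure \<Rightarrow> real" where
  "diff_entropy P = - (\<integral>x. enn2real (RN_deriv lborel P x) * ln (enn2real (RN_deriv lborel P x)) \<partial>lborel)"

text \<open>H_{m,n}(X) = n H([X_1^{(n)}]_m), where P is the law of X_1^{(n)}.\<close>
definition H_mn :: "real measure \<Rightarrow> nat \<Rightarrow> nat \<Rightarrow> ereal" where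
  "H_mn P m n = ereal (real n) * quant_entropy P m"

end

theory Submission
  imports Defs "HOL-Real_Asymp.Real_Asymp"
begin

text \<open>
  By uniqueness of characteristic functions the increment over \<open>[0, 1/n]\<close> has the law of
  \<open>a X\<^sub>0 + b\<close> with \<open>a = n powr (-1/\<alpha>)\<close>, so quantising it with step \<open>1/m\<close> amounts to quantising
  \<open>X\<^sub>0\<close> with step \<open>1/s\<close>, where \<open>s = m a\<close>, on a translated grid. If \<open>q\<close> is the density \<open>p\<close> of \<open>X\<^sub>0\<close>
  averaged over the cells of this grid, the discrete entropy equals \<open>ln s + h(q)\<close>, and it
  remains to see that \<open>h(q)\<close> tends to \<open>h(p)\<close> as \<open>s \<rightarrow> \<infinity>\<close>, uniformly over translations of the grid.
  Since the characteristic function decays like \<open>exp (-c |t| powr \<alpha>)\<close>, \<open>p\<close> is bounded and Lipschitz,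
  so \<open>q \<rightarrow> p\<close> uniformly, which settles bounded intervals. The tails are controlled by
  \<open>|u ln u| \<le> 1 / (1 + x^2) + (ln (1 + x^2) + B) u\<close> and finiteness of \<open>E ln (1 + X\<^sub>0^2)\<close>, which follows from
  the Hoelder bound \<open>1 - Re \<phi>(t) \<le> C |t| powr \<delta>\<close>.
\<close>

section \<open>Densities from integrable characteristic functions\<close>

text \<open>The inversion formula; \<open>Re\<close> gives a real-valued function without first
  showing that the integral is real.\<close>

definition fourier_density :: "real measure \<Rightarrow> real \<Rightarrow> real" where
  "fourier_density M x = Re (CLBINT t. iexp (-(t * x)) * char M t) / (2 * pi)"

text \<open>Identifies the kernel in Levy's inversion theorem as the Fourier transform of an
  interval, which brings it into a form suited to Fubini.\<close>

lemma integral_iexp_Icc: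
  fixes a b t :: real
  assumes "a \<le> b" "t \<noteq> 0"
  shows "(CLBINT x. indicator {a..b} x *\<^sub>R iexp (-(t * x)))
    = (iexp (-(t * a)) - iexp (-(t * b))) / (\<i> * t)"
proof -
  let ?F = "\<lambda>x. iexp (-(t * x)) * (\<i> / t)"
  have "((\<lambda>x. iexp (-(t * x)) * (\<i> / t)) has_vector_derivative iexp (-(t * x))) (at x within {a..b})" for x
    using assms(2)
    by (auto intro!: derivative_eq_intros simp: Re_exp Im_exp has_vector_derivative_complex_iff field_simps)
  then have "(CLBINT x. indicator {a..b} x *\<^sub>R iexp (-(t * x))) = ?F b - ?F a"
    by (intro integral_FTC_Icc assms) (auto intro!: continuous_intros)
  also have "\<dots> = (iexp (-(t * a)) - iexp (-(t * b))) / (\<i> * t)"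
    using assms(2) by (simp add: field_simps)
  finally show ?thesis .
qed

context real_distribution
begin

context
  assumes int_char: "integrable lborel (char M)"
begin

lemma integrable_iexp_char: "integrable lborel (\<lambda>t. iexp (-(t * x)) * char M t)"
  by (rule Bochner_Integration.integrable_bound[OF int_char]) (auto simp: norm_mult)

lemma fourier_density_bound: "\<bar>fourier_density M x\<bar> \<le> (LBINT t. cmod (char M t))"
proof -
  have "\<bar>Re (CLBINT t. iexp (-(t * x)) * char M t)\<bar> \<le> cmod (CLBINT t. iexp (-(t * x)) * char M t)"
    by (rule abs_Re_le_cmod)
  also have "\<dots> \<le> (LBINT t. cmod (iexp (-(t * x)) * char M t))"
    by (rule integral_norm_bound)
  also have "\<dots> = (LBINT t. cmod (char M t))"
    by (simp add: norm_mult)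
  finally have *: "\<bar>Re (CLBINT t. iexp (-(t * x)) * char M t)\<bar> \<le> (LBINT t. cmod (char M t))" .
  have "\<bar>fourier_density M x\<bar> = \<bar>Re (CLBINT t. iexp (-(t * x)) * char M t)\<bar> / (2 * pi)"
    by (simp add: fourier_density_def)
  also have "\<dots> \<le> \<bar>Re (CLBINT t. iexp (-(t * x)) * char M t)\<bar> / 1"
    using pi_gt3 by (intro divide_left_mono) auto
  finally show ?thesis using * by simp
qed

lemma fourier_density_measurable [measurable]: "fourier_density M \<in> borel_measurable borel"
  unfolding fourier_density_def[abs_def] by measurable

lemma integrable_fourier_density_Icc:
  "integrable lborel (\<lambda>x. indicator {a..b} x * fourier_density M x)"
  by (rule integrableI_bounded_set[where A = "{a..b}" and B = "LBINT t. cmod (char M t)"])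
    (auto simp: emeasure_lborel_Icc_eq intro!: AE_I2 fourier_density_bound split: split_indicator)

text \<open>Levy inversion at continuity points: integrability of \<open>char M\<close> lets the
  truncation \<open>T\<close> go to infinity by dominated convergence, and Fubini then makes the
  integral over the interval the outer one.\<close>

lemma measure_Ioc_eq_fourier_density_aux:
  assumes "a \<le> b" and a: "measure M {a} = 0" and b: "measure M {b} = 0"
  shows "measure M {a<..b} = (LBINT x. indicator {a..b} x * fourier_density M x)"
proof -
  let ?G = "\<lambda>t. (CLBINT x. indicator {a..b} x *\<^sub>R iexp (-(t * x)))"
  let ?F = "\<lambda>t::real. (iexp (-(t * a)) - iexp (-(t * b))) / (\<i> * t)"
  have G_bound: "cmod (?G t) \<le> b - a" for t
  proof -
    have "cmod (?G t) \<le> (LBINT x. cmod (indicator {a..b} x *\<^sub>R iexp (-(t * x))))"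
      by (rule integral_norm_bound)
    also have "\<dots> = (LBINT x. indicator {a..b} x)"
      by (intro Bochner_Integration.integral_cong) (auto split: split_indicator)
    also have "\<dots> = b - a"
      using \<open>a \<le> b\<close> by simp
    finally show ?thesis .
  qed
  have [measurable]: "?G \<in> borel_measurable borel"
    by measurable
  have bound: "norm (?G t * char M t) \<le> (b - a) * cmod (char M t)" for t
    using G_bound[of t] by (auto simp: norm_mult intro!: mult_right_mono)
  have Int: "integrable lborel (\<lambda>t. (b - a) * cmod (char M t))"
    using int_char by auto
  have eq: "(CLBINT t=-real T..real T. ?F t * char M t)
      = (CLBINT t. indicator {-real T<..<real T} t *\<^sub>R (?G t * char M t))" for T :: nat
  proof -
    have "(CLBINT t=-real T..real T. ?F t * char M t)
       = (CLBINT t. indicator {-real T<..<real T} t *\<^sub>R (?F t * char M t))"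
      by (simp add: interval_lebesgue_integral_def set_lebesgue_integral_def)
    also have "\<dots> = (CLBINT t. indicator {-real T<..<real T} t *\<^sub>R (?G t * char M t))"
    \<comment> \<open>At \<open>t = 0\<close> the quotient \<open>?F\<close> is 0 by the convention
      for division, whereas \<open>?G 0 = b - a\<close>; a single point is a null set.\<close>
    proof (rule integral_cong_AE)
      show "AE t in lborel. indicator {-real T<..<real T} t *\<^sub>R (?F t * char M t)
          = indicator {-real T<..<real T} t *\<^sub>R (?G t * char M t)"
        using AE_lborel_singleton[of 0]
      proof eventually_elim
        case (elim t) then show ?case
          by (simp only: integral_iexp_Icc[OF \<open>a \<le> b\<close> elim])
      qed
    qed measurable
    finally show ?thesis .
  qed
  have "(\<lambda>T::nat. CLBINT t. indicator {-real T<..<real T} t *\<^sub>R (?G t * char M t))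
      \<longlonglongrightarrow> (CLBINT t. ?G t * char M t)"
  proof (rule integral_dominated_convergence[OF _ _ Int])
    show "AE t in lborel. (\<lambda>T::nat. indicator {-real T<..<real T} t *\<^sub>R (?G t * char M t))
      \<longlonglongrightarrow> ?G t * char M t"
    proof (rule AE_I2)
      fix t :: real
      obtain N where N: "\<bar>t\<bar> < real N" using reals_Archimedean2 by blast
      have "eventually (\<lambda>T::nat. indicator {-real T<..<real T} t *\<^sub>R (?G t * char M t) = ?G t * char M t) sequentially"
        using eventually_ge_at_top[of N]
        by eventually_elim (use N in \<open>auto split: split_indicator\<close>)
      then show "(\<lambda>T::nat. indicator {-real T<..<real T} t *\<^sub>R (?G t * char M t))
        \<longlonglongrightarrow> ?G t * char M t"
        by (rule tendsto_eventually)
    qed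
    show "AE t in lborel. norm (indicator {-real T<..<real T} t *\<^sub>R (?G t * char M t))
       \<le> (b - a) * cmod (char M t)" for T :: nat
      using bound \<open>a \<le> b\<close> by (intro AE_I2) (auto split: split_indicator)
  qed measurable
  then have "(\<lambda>T::nat. 1 / (2 * pi) * (CLBINT t=-real T..real T. ?F t * char M t))
      \<longlonglongrightarrow> 1 / (2 * pi) * (CLBINT t. ?G t * char M t)"
    unfolding eq by (intro tendsto_intros)
  with Levy_Inversion[OF \<open>a \<le> b\<close> a b]
  have 1: "complex_of_real (measure M {a<..b}) = 1 / (2 * pi) * (CLBINT t. ?G t * char M t)"
    by (intro LIMSEQ_unique) auto
  have "(CLBINT t. ?G t * char M t)
      = (CLBINT t. (CLBINT x. indicator {a..b} x *\<^sub>R (iexp (-(t * x)) * char M t)))"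
    by (simp flip: integral_mult_left_zero)
  also have "\<dots> = (CLBINT x. (CLBINT t. indicator {a..b} x *\<^sub>R (iexp (-(t * x)) * char M t)))"
  \<comment> \<open>Integrating the norm over \<open>x\<close> first leaves
    \<open>(b - a) * cmod (char M t)\<close>, which is integrable.\<close>
  proof (rule lborel_pair.Fubini_integral[symmetric], rule lborel_pair.Fubini_integrable)
    have "(LBINT x. cmod (case (t, x) of (t, x) \<Rightarrow> indicator {a..b} x *\<^sub>R (iexp (-(t * x)) * char M t)))
       = (b - a) * cmod (char M t)" for t
    proof -
      have "(LBINT x. cmod (case (t, x) of (t, x) \<Rightarrow> indicator {a..b} x *\<^sub>R (iexp (-(t * x)) * char M t)))
        = (LBINT x. indicator {a..b} x * cmod (char M t))"
        by (intro Bochner_Integration.integral_cong) (auto simp: norm_mult split: split_indicator)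
      then show ?thesis using \<open>a \<le> b\<close> by simp
    qed
    then show "integrable lborel (\<lambda>t. LBINT x. cmod (case (t, x) of (t, x) \<Rightarrow>
         indicator {a..b} x *\<^sub>R (iexp (-(t * x)) * char M t)))"
      using Int by simp
    show "AE t in lborel. integrable lborel (\<lambda>x. case (t, x) of (t, x) \<Rightarrow>
         indicator {a..b} x *\<^sub>R (iexp (-(t * x)) * char M t))"
      by (rule AE_I2)
        (auto intro!: integrableI_bounded_set[where A = "{a..b}" and B = "cmod (char M _)"]
           simp: norm_mult emeasure_lborel_Icc_eq)
  qed measurable
  also have "\<dots> = (CLBINT x. indicator {a..b} x *\<^sub>R (CLBINT t. iexp (-(t * x)) * char M t))"
    by simp
  finally have 2: "(CLBINT t. ?G t * char M t) =
    (CLBINT x. indicator {a..b} x *\<^sub>R (CLBINT t. iexp (-(t * x)) * char M t))" .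
  have "integrable lborel (\<lambda>x. indicator {a..b} x *\<^sub>R (CLBINT t. iexp (-(t * x)) * char M t))"
  proof (rule integrableI_bounded_set[where A = "{a..b}" and B = "LBINT t. cmod (char M t)"])
    show "AE x\<in>{a..b} in lborel. norm (indicator {a..b} x *\<^sub>R (CLBINT t. iexp (-(t * x)) * char M t)) \<le> (LBINT t. cmod (char M t))"
    proof (rule AE_I2, rule impI)
      fix x assume "x \<in> {a..b}"
      then have "norm (indicator {a..b} x *\<^sub>R (CLBINT t. iexp (-(t * x)) * char M t))
        \<le> (LBINT t. cmod (iexp (-(t * x)) * char M t))"
        by (simp add: integral_norm_bound)
      then show "norm (indicator {a..b} x *\<^sub>R (CLBINT t. iexp (-(t * x)) * char M t)) \<le> (LBINT t. cmod (char M t))"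
        by (simp add: norm_mult)
    qed
  qed (auto simp: emeasure_lborel_Icc_eq)
  then have "Re (CLBINT x. indicator {a..b} x *\<^sub>R (CLBINT t. iexp (-(t * x)) * char M t))
    = (LBINT x. indicator {a..b} x * Re (CLBINT t. iexp (-(t * x)) * char M t))"
    by (subst integral_Re[symmetric]) auto
  moreover have "measure M {a<..b} = Re (1 / (2 * pi) * (CLBINT t. ?G t * char M t))"
    using 1 by (metis Re_complex_of_real)
  ultimately show ?thesis
    unfolding 2 fourier_density_def by simp
qed

text \<open>There are only countably many atoms, so non-atoms lie arbitrarily close to
  \<open>x\<close> on both sides; the interval between two of them has mass at most its length times
  a bound for the density.\<close>

lemma measure_singleton_eq_0_if_integrable_char: "measure M {x} = 0"
proof -
  define C where "C = (LBINT t. cmod (char M t))"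
  have C: "0 \<le> C" unfolding C_def by simp
  then have C1: "0 < 2 * C + 1" by linarith
  have "measure M {x} \<le> e * (2 * C)" if "e > 0" for e
  proof -
    have ct: "countable {x. measure M {x} \<noteq> 0}" by (rule countable_support)
    from open_minus_countable[OF ct, of "{x - e<..<x}"] that
    obtain a where a: "measure M {a} = 0" "x - e < a" "a < x" by auto
    from open_minus_countable[OF ct, of "{x<..<x + e}"] that
    obtain b where b: "measure M {b} = 0" "x < b" "b < x + e" by auto
    have "measure M {x} \<le> measure M {a<..b}"
      using a b by (intro finite_measure_mono) auto
    also have "\<dots> = (LBINT x. indicator {a..b} x * fourier_density M x)"
      using a b by (intro measure_Ioc_eq_fourier_density_aux) auto
    also have "\<dots> \<le> (LBINT x. indicator {a..b} x * C)"
      using fourier_density_bound unfolding C_def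
      by (intro integral_mono integrable_fourier_density_Icc)
        (auto simp: abs_le_iff emeasure_lborel_Icc_eq split: split_indicator)
    also have "\<dots> = (b - a) * C"
      using a b by simp
    also have "\<dots> \<le> (2 * e) * C"
      using a b C by (intro mult_right_mono) auto
    finally show ?thesis by simp
  qed
  note * = this
  have "measure M {x} \<le> 0 + e" if "e > 0" for e
  proof -
    \<comment> \<open>The denominator \<open>2 * C + 1\<close> avoids a separate case
      \<open>C = 0\<close>.\<close>
    have "measure M {x} \<le> e / (2 * C + 1) * (2 * C)"
      by (intro * divide_pos_pos that C1)
    also have "\<dots> = e * (2 * C / (2 * C + 1))" by simp
    also have "\<dots> \<le> e * 1"
      using C1 that by (intro mult_left_mono) (auto simp: divide_le_eq_1)
    finally show ?thesis by simp
  qed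
  then have "measure M {x} \<le> 0"
    by (rule field_le_epsilon)
  then show ?thesis
    using measure_nonneg[of M "{x}"] by linarith
qed

lemma measure_Ioc_eq_fourier_density:
  "a \<le> b \<Longrightarrow> measure M {a<..b} = (LBINT x. indicator {a..b} x * fourier_density M x)"
  by (intro measure_Ioc_eq_fourier_density_aux measure_singleton_eq_0_if_integrable_char)

end

section \<open>Lipschitz bound and sign of the density, identification of the law\<close>

context
  assumes int_char: "integrable lborel (char M)"
    and int_id_char: "integrable lborel (\<lambda>t. \<bar>t\<bar> * cmod (char M t))"
begin

text \<open>The kernel \<open>iexp (-(t * x))\<close> is Lipschitz in \<open>x\<close> with constant
  \<open>|t|\<close>, and this weight is integrable against \<open>cmod (char M t)\<close>.\<close>

lemma fourier_density_lipschitz: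
  "\<bar>fourier_density M x - fourier_density M y\<bar> \<le> (LBINT t. \<bar>t\<bar> * cmod (char M t)) * \<bar>x - y\<bar>"
proof -
  have le: "cmod (iexp (-(t * x)) - iexp (-(t * y))) \<le> \<bar>t\<bar> * \<bar>x - y\<bar>" for t
  proof -
    have "iexp (-(t * x)) - iexp (-(t * y)) = iexp (-(t * y)) * (iexp (t * (y - x)) - 1)"
      by (simp add: algebra_simps flip: exp_add)
    then have "cmod (iexp (-(t * x)) - iexp (-(t * y))) = cmod (iexp (t * (y - x)) - 1)"
      by (simp add: norm_mult)
    also have "\<dots> \<le> \<bar>t * (y - x)\<bar>"
      using iexp_approx1[of "t * (y - x)" 0] by simp
    finally show ?thesis by (simp add: abs_mult abs_minus_commute)
  qed
  have "(CLBINT t. iexp (-(t * x)) * char M t) - (CLBINT t. iexp (-(t * y)) * char M t)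
    = (CLBINT t. iexp (-(t * x)) * char M t - iexp (-(t * y)) * char M t)"
    by (intro Bochner_Integration.integral_diff[symmetric] integrable_iexp_char[OF int_char])
  also have "\<dots> = (CLBINT t. (iexp (-(t * x)) - iexp (-(t * y))) * char M t)"
    by (simp add: algebra_simps)
  finally have "cmod ((CLBINT t. iexp (-(t * x)) * char M t) - (CLBINT t. iexp (-(t * y)) * char M t))
    \<le> (LBINT t. cmod ((iexp (-(t * x)) - iexp (-(t * y))) * char M t))"
    by (simp add: integral_norm_bound)
  also have "\<dots> \<le> (LBINT t. (\<bar>t\<bar> * cmod (char M t)) * \<bar>x - y\<bar>)"
  proof (rule integral_mono')
    show "cmod ((iexp (-(t * x)) - iexp (-(t * y))) * char M t) \<le> (\<bar>t\<bar> * cmod (char M t)) * \<bar>x - y\<bar>" for t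
      using mult_right_mono[OF le[of t], of "cmod (char M t)"] by (simp add: norm_mult mult_ac)
  qed (use int_id_char in auto)
  also have "\<dots> = (LBINT t. \<bar>t\<bar> * cmod (char M t)) * \<bar>x - y\<bar>"
    by simp
  finally have *: "cmod ((CLBINT t. iexp (-(t * x)) * char M t) - (CLBINT t. iexp (-(t * y)) * char M t))
    \<le> (LBINT t. \<bar>t\<bar> * cmod (char M t)) * \<bar>x - y\<bar>" .
  have "\<bar>fourier_density M x - fourier_density M y\<bar>
     = \<bar>Re ((CLBINT t. iexp (-(t * x)) * char M t) - (CLBINT t. iexp (-(t * y)) * char M t))\<bar> / (2 * pi)"
    by (simp add: fourier_density_def flip: diff_divide_distrib)
  also have "\<dots> \<le> \<bar>Re ((CLBINT t. iexp (-(t * x)) * char M t) - (CLBINT t. iexp (-(t * y)) * char M t))\<bar> / 1"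
    using pi_gt3 by (intro divide_left_mono) auto
  also have "\<dots> \<le> cmod ((CLBINT t. iexp (-(t * x)) * char M t) - (CLBINT t. iexp (-(t * y)) * char M t))"
    unfolding div_by_1 by (rule abs_Re_le_cmod)
  finally show ?thesis using * by linarith
qed

text \<open>By the Lipschitz bound a negative value would force values at most half of it on a short
  interval, which would then have negative measure.\<close>

lemma fourier_density_nonneg: "0 \<le> fourier_density M x"
proof (rule ccontr)
  let ?p = "fourier_density M" 
  assume "\<not> 0 \<le> ?p x"
  then have neg: "?p x < 0" by simp
  define K where "K = (LBINT t. \<bar>t\<bar> * cmod (char M t))"
  have K: "0 \<le> K" unfolding K_def by (rule integral_nonneg_AE) auto
  \<comment> \<open>Chosen so that \<open>(K + 1) * d = - ?p x / 2\<close>; the summand 1 keeps the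
    denominator positive when \<open>K = 0\<close>.\<close>
  define d where "d = - ?p x / (2 * (K + 1))"
  have "0 < 2 * (K + 1)" using K by simp
  then have d: "0 < d" unfolding d_def using neg by (intro divide_pos_pos) auto
  have "?p y \<le> ?p x / 2" if "y \<in> {x..x + d}" for y
  proof -
    have "?p y - ?p x \<le> K * \<bar>y - x\<bar>" using fourier_density_lipschitz[of y x] unfolding K_def by linarith
    also have "\<dots> \<le> (K + 1) * d" using that K by (intro mult_mono) auto
    also have "\<dots> = - ?p x / 2" using K by (simp add: d_def field_simps)
    finally show ?thesis by simp
  qed
  then have "(LBINT y. indicator {x..x + d} y * ?p y) \<le> (LBINT y. indicator {x..x + d} y * (?p x / 2))"
    by (intro integral_mono integrable_fourier_density_Icc[OF int_char])
      (auto simp: emeasure_lborel_Icc_eq split: split_indicator)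
  also have "\<dots> = d * (?p x / 2)" using d by simp
  also have "\<dots> < 0" using d neg by (simp add: mult_pos_neg)
  finally have "measure M {x<..x + d} < 0"
    using measure_Ioc_eq_fourier_density[OF int_char, of x "x + d"] d by simp
  then show False using measure_nonneg[of M "{x<..x + d}"] by linarith
qed

text \<open>Both measures agree on half-open intervals, an intersection-stable generator, and
  intervals of finite mass exhaust the line.\<close>

lemma eq_density_fourier_density: "M = density lborel (fourier_density M)"
proof (rule measure_eqI_generator_eq[where \<Omega>=UNIV])
  note [measurable] = fourier_density_measurable[OF int_char]
  fix X assume "X \<in> range (\<lambda>(a, b). {a<..b::real})"
  then obtain a b where X: "X = {a<..b}" by auto
  show "emeasure M X = emeasure (density lborel (fourier_density M)) X"
  proof (cases "a \<le> b")
    case True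
    have "emeasure (density lborel (fourier_density M)) X
       = (\<integral>\<^sup>+ x. ennreal (fourier_density M x) * indicator {a<..b} x \<partial>lborel)"
      unfolding X by (rule emeasure_density) auto
    also have "\<dots> = (\<integral>\<^sup>+ x. ennreal (indicator {a..b} x * fourier_density M x) \<partial>lborel)"
      by (rule nn_integral_cong_AE)
        (use AE_lborel_singleton[of a] in \<open>eventually_elim, auto split: split_indicator\<close>)
    also have "\<dots> = ennreal (LBINT x. indicator {a..b} x * fourier_density M x)"
      by (rule nn_integral_eq_integral)
        (auto intro!: integrable_fourier_density_Icc[OF int_char] AE_I2 mult_nonneg_nonneg fourier_density_nonneg)
    also have "\<dots> = emeasure M X"
      unfolding X emeasure_eq_measure using measure_Ioc_eq_fourier_density[OF int_char True] by simp
    finally show ?thesis by simp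
  qed (simp add: X)
next
  show "(\<Union>i. {- real (i::nat)<..real i}) = UNIV"
    by (rule UN_Ioc_eq_UNIV)
qed (auto simp: borel_sigma_sets_Ioc Int_stable_def)

end

end

section \<open>Logarithmic moments from characteristic functions\<close>

text \<open>The standard normal law has characteristic function \<open>exp (- t^2 / 2)\<close>, so
  Fubini turns a Gaussian average of \<open>1 - Re (char M)\<close> at scale \<open>u\<close> into
  the integral of a function that detects \<open>|x|\<close> beyond \<open>1 / u\<close>.\<close>

lemma (in real_distribution) integral_one_minus_char_std_normal:
  "(\<integral>t. 1 - Re (char M (u * t)) \<partial>std_normal_distribution) = (\<integral>x. 1 - exp (- (u * x)\<^sup>2 / 2) \<partial>M)"
proof -
  interpret N: real_distribution std_normal_distribution
    by (rule real_dist_normal_dist)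
  interpret P: pair_prob_space std_normal_distribution M ..
  have [measurable]: "char M \<in> borel_measurable borel" by simp
  have int: "integrable std_normal_distribution (\<lambda>t. char M (u * t))"
    by (rule N.integrable_const_bound[where B = 1]) (auto simp: cmod_char_le_1)
  have "(\<integral>t. char M (u * t) \<partial>std_normal_distribution)
      = (\<integral>t. (\<integral>x. iexp (u * t * x) \<partial>M) \<partial>std_normal_distribution)"
    by (simp add: char_def)
  also have "\<dots> = (\<integral>x. (\<integral>t. iexp (u * t * x) \<partial>std_normal_distribution) \<partial>M)"
    by (rule P.Fubini_integral[symmetric], rule P.P.integrable_const_bound[where B = 1])
      (auto intro!: AE_I2)
  also have "\<dots> = (\<integral>x. char std_normal_distribution (u * x) \<partial>M)"
    by (simp add: char_def mult_ac)
  also have "\<dots> = complex_of_real (\<integral>x. exp (- (u * x)\<^sup>2 / 2) \<partial>M)"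
    by (simp add: char_std_normal_distribution)
  finally have "(\<integral>t. Re (char M (u * t)) \<partial>std_normal_distribution) = (\<integral>x. exp (- (u * x)\<^sup>2 / 2) \<partial>M)"
    using int by (subst integral_Re) auto
  moreover have "integrable M (\<lambda>x. exp (- (u * x)\<^sup>2 / 2))"
    by (rule integrable_const_bound[where B = 1]) auto
  ultimately show ?thesis
    using int N.prob_space prob_space
    by (subst (1 2) Bochner_Integration.integral_diff) (auto simp del: space_eq_univ N.space_eq_univ)
qed

text \<open>Every \<open>k\<close> with \<open>2 ^ k \<le> |x|\<close> contributes at least
  \<open>c\<close> to the sum, and \<open>ln (1 + x^2)\<close> is at most 1 plus twice the number of
  such \<open>k\<close>.\<close>

lemma ln_one_plus_square_le_dyadic_sum:
  fixes x :: real
  defines "c \<equiv> 1 - exp (- 1 / 2)"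
  shows "ennreal (ln (1 + x\<^sup>2)) \<le> 1 + ennreal (2 / c) * (\<Sum>k. ennreal (1 - exp (- ((1 / 2) ^ k * x)\<^sup>2 / 2)))"
proof -
  have c: "0 < c" by (simp add: c_def)
  obtain n0 where n0: "\<bar>x\<bar> < 2 ^ n0"
    using real_arch_pow[of 2 "\<bar>x\<bar>"] by auto
  \<comment> \<open>Minimality makes the exponents \<open>k < n\<close> exactly those with
    \<open>2 ^ k \<le> |x|\<close>.\<close>
  define n where "n = (LEAST n. \<bar>x\<bar> < 2 ^ n)"
  have n: "\<bar>x\<bar> < 2 ^ n" unfolding n_def by (rule LeastI[of _ n0]) (rule n0)
  have small: "2 ^ k \<le> \<bar>x\<bar>" if "k < n" for k
    using not_less_Least[of k "\<lambda>n. \<bar>x\<bar> < 2 ^ n"] that unfolding n_def by simp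
  have "c \<le> 1 - exp (- ((1 / 2) ^ k * x)\<^sup>2 / 2)" if "k < n" for k
  proof -
    have "1 \<le> (1 / 2) ^ k * \<bar>x\<bar>" using small[OF that] by (simp add: field_simps power_divide)
    then have "1\<^sup>2 \<le> ((1 / 2) ^ k * \<bar>x\<bar>)\<^sup>2" by (intro power_mono) auto
    then have "1 \<le> ((1 / 2) ^ k * x)\<^sup>2" by (simp add: power_mult_distrib)
    then show ?thesis by (simp add: c_def)
  qed
  then have sum: "real n * c \<le> (\<Sum>k<n. 1 - exp (- ((1 / 2) ^ k * x)\<^sup>2 / 2))"
    using sum_mono[of "{..<n}" "\<lambda>_. c"] by simp
  have "x\<^sup>2 \<le> (2 ^ n)\<^sup>2" using n by (subst abs_le_square_iff[symmetric]) auto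
  then have "x\<^sup>2 \<le> 4 ^ n" by (simp add: power_mult power_mult_distrib power2_eq_square flip: power_mult_distrib)
  moreover have "(1::real) \<le> 4 ^ n" by simp
  ultimately have "1 + x\<^sup>2 \<le> 2 * 4 ^ n" by linarith
  moreover have "0 < 1 + x\<^sup>2" by (simp add: add_pos_nonneg)
  ultimately have "ln (1 + x\<^sup>2) \<le> ln (2 * 4 ^ n)" by simp
  also have "\<dots> = ln 2 + real n * ln (2 ^ 2)" by (simp add: ln_mult ln_realpow)
  also have "\<dots> = ln 2 + real n * (2 * ln 2)" by (subst ln_realpow) auto
  also have "\<dots> \<le> 1 + real n * (2 * 1)"
    using ln_2_less_1 by (intro add_mono mult_left_mono) auto
  also have "\<dots> = 1 + (2 / c) * (real n * c)" using c by simp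
  also have "\<dots> \<le> 1 + (2 / c) * (\<Sum>k<n. 1 - exp (- ((1 / 2) ^ k * x)\<^sup>2 / 2))"
    using c sum by (intro add_left_mono mult_left_mono) auto
  finally have "ennreal (ln (1 + x\<^sup>2)) \<le> ennreal (1 + (2 / c) * (\<Sum>k<n. 1 - exp (- ((1 / 2) ^ k * x)\<^sup>2 / 2)))"
    by (rule ennreal_leI)
  also have "\<dots> = 1 + ennreal (2 / c) * (\<Sum>k<n. ennreal (1 - exp (- ((1 / 2) ^ k * x)\<^sup>2 / 2)))"
    using c by (subst sum_ennreal) (auto simp: sum_nonneg simp del: times_divide_eq_left times_divide_eq_right simp flip: ennreal_mult)
  also have "\<dots> \<le> 1 + ennreal (2 / c) * (\<Sum>k. ennreal (1 - exp (- ((1 / 2) ^ k * x)\<^sup>2 / 2)))"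
    by (intro add_left_mono mult_left_mono sum_le_suminf) auto
  finally show ?thesis .
qed

text \<open>Averaging the hypothesis over a Gaussian of standard deviation \<open>(1/2)^k\<close> bounds the mass
  outside \<open>[-2^k, 2^k]\<close> by a geometric sequence.\<close>

lemma (in real_distribution) integrable_ln_one_plus_square:
  assumes char_le: "\<And>t. 1 - Re (char M t) \<le> C * \<bar>t\<bar> powr \<delta>"
    and \<delta>: "0 < \<delta>" "\<delta> \<le> 2" and C: "0 \<le> C"
  shows "integrable M (\<lambda>x. ln (1 + x\<^sup>2))"
proof -
  interpret N: real_distribution std_normal_distribution
    by (rule real_dist_normal_dist)
  have [measurable]: "char M \<in> borel_measurable borel" by simp
  define D where "D = (\<integral>t. 1 + t\<^sup>2 \<partial>std_normal_distribution)"
  have D: "0 \<le> D" unfolding D_def by (intro integral_nonneg_AE) auto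
  have intN: "integrable std_normal_distribution (\<lambda>t. 1 + t\<^sup>2)"
    using integrable_std_normal_distribution_moment[of 2] by auto
  \<comment> \<open>Since \<open>\<delta> \<le> 2\<close>, the second moment of the Gaussian
    controls the average of the hypothesis.\<close>
  have powr_le: "\<bar>t\<bar> powr \<delta> \<le> 1 + t\<^sup>2" for t :: real
  proof (cases "\<bar>t\<bar> \<le> 1")
    case True
    then have "\<bar>t\<bar> powr \<delta> \<le> 1" using \<delta> by (intro powr_le1) auto
    then show ?thesis using zero_le_power2[of t] by linarith
  next
    case False
    then have "\<bar>t\<bar> powr \<delta> \<le> \<bar>t\<bar> powr 2" using \<delta> by (intro powr_mono) auto
    then show ?thesis using False by simp
  qed
  have term_le: "(\<integral>x. 1 - exp (- (u * x)\<^sup>2 / 2) \<partial>M) \<le> C * D * u powr \<delta>" if "0 < u" for u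
  proof -
    have "(\<integral>x. 1 - exp (- (u * x)\<^sup>2 / 2) \<partial>M) = (\<integral>t. 1 - Re (char M (u * t)) \<partial>std_normal_distribution)"
      by (rule integral_one_minus_char_std_normal[symmetric])
    also have "\<dots> \<le> (\<integral>t. (C * u powr \<delta>) * (1 + t\<^sup>2) \<partial>std_normal_distribution)"
    proof (rule integral_mono')
      fix t :: real
      have "1 - Re (char M (u * t)) \<le> C * \<bar>u * t\<bar> powr \<delta>" by (rule char_le)
      also have "\<dots> = (C * u powr \<delta>) * \<bar>t\<bar> powr \<delta>" using that by (simp add: abs_mult powr_mult)
      also have "\<dots> \<le> (C * u powr \<delta>) * (1 + t\<^sup>2)" using C powr_le by (intro mult_left_mono) auto
      finally show "1 - Re (char M (u * t)) \<le> (C * u powr \<delta>) * (1 + t\<^sup>2)" .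
    qed (use intN C in auto)
    also have "\<dots> = C * D * u powr \<delta>" by (simp add: D_def)
    finally show ?thesis .
  qed
  let ?f = "\<lambda>k x. 1 - exp (- ((1 / 2) ^ k * x)\<^sup>2 / 2) :: real"
  \<comment> \<open>At \<open>u = (1/2) ^ k\<close> the factor \<open>u powr \<delta>\<close> is
    \<open>r ^ k\<close>, so the bounds from \<open>term_le\<close> form a convergent geometric
    series.\<close>
  define r where "r = (1 / 2 :: real) powr \<delta>"
  have r: "0 \<le> r" "r < 1"
    using \<delta> powr_less_mono2_neg[of "-\<delta>" 1 2] by (auto simp: r_def powr_divide powr_minus divide_simps)
  have "(\<integral>\<^sup>+ x. (\<Sum>k. ennreal (?f k x)) \<partial>M) = (\<Sum>k. (\<integral>\<^sup>+ x. ennreal (?f k x) \<partial>M))"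
    by (rule nn_integral_suminf) auto
  also have "\<dots> \<le> (\<Sum>k. ennreal (C * D * r ^ k))"
  proof (rule suminf_le)
    fix k :: nat
    have "integrable M (?f k)"
      by (rule integrable_const_bound[where B = 1]) auto
    then have "(\<integral>\<^sup>+ x. ennreal (?f k x) \<partial>M) = ennreal (\<integral>x. ?f k x \<partial>M)"
      by (rule nn_integral_eq_integral) auto
    also have "\<dots> \<le> ennreal (C * D * ((1 / 2) ^ k) powr \<delta>)"
      by (intro ennreal_leI term_le) auto
    also have "((1 / 2 :: real) ^ k) powr \<delta> = r ^ k"
      by (simp add: r_def powr_powr mult.commute flip: powr_realpow)
    finally show "(\<integral>\<^sup>+ x. ennreal (?f k x) \<partial>M) \<le> ennreal (C * D * r ^ k)" .
  qed auto
  also have "\<dots> = ennreal (\<Sum>k. C * D * r ^ k)"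
    using r C D by (intro suminf_ennreal2) (auto intro!: summable_mult summable_geometric)
  also have "\<dots> < top" by simp
  finally have fin: "(\<integral>\<^sup>+ x. (\<Sum>k. ennreal (?f k x)) \<partial>M) < top" .
  show ?thesis
  proof (rule integrableI_bounded)
    let ?c = "1 - exp (- 1 / 2) :: real"
    have "(\<integral>\<^sup>+ x. ennreal (norm (ln (1 + x\<^sup>2))) \<partial>M)
       \<le> (\<integral>\<^sup>+ x. 1 + ennreal (2 / ?c) * (\<Sum>k. ennreal (?f k x)) \<partial>M)"
    proof (rule nn_integral_mono)
      fix x
      have "norm (ln (1 + x\<^sup>2)) = ln (1 + x\<^sup>2)" by simp
      then show "ennreal (norm (ln (1 + x\<^sup>2))) \<le> 1 + ennreal (2 / ?c) * (\<Sum>k. ennreal (?f k x))"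
        using ln_one_plus_square_le_dyadic_sum[of x] by (simp only:)
    qed
    also have "\<dots> = 1 + ennreal (2 / ?c) * (\<integral>\<^sup>+ x. (\<Sum>k. ennreal (?f k x)) \<partial>M)"
      using emeasure_space_1 by (simp add: nn_integral_add nn_integral_cmult del: space_eq_univ times_divide_eq_left)
    also have "\<dots> < \<infinity>"
      using fin by (simp add: ennreal_mult_less_top ennreal_add_less_top)
    finally show "(\<integral>\<^sup>+ x. ennreal (norm (ln (1 + x\<^sup>2))) \<partial>M) < \<infinity>" .
  qed measurable
qed

section \<open>Stable exponents\<close>

text \<open>For \<open>z\<close> with real part \<open>a\<close> and imaginary part
  \<open>b\<close>, \<open>1 - exp a * cos b = (1 - exp a) + exp a * (1 - cos b)\<close>, and both
  summands have linear bounds.\<close>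

lemma one_minus_Re_exp_le:
  assumes "Re z \<le> 0"
  shows "1 - Re (exp z) \<le> \<bar>Re z\<bar> + \<bar>Im z\<bar>"
proof -
  have "1 - cos (Im z) = 2 * (sin (Im z / 2))\<^sup>2"
    using cos_double_sin[of "Im z / 2"] by simp
  also have "\<dots> = 2 * (\<bar>sin (Im z / 2)\<bar> * \<bar>sin (Im z / 2)\<bar>)"
    by (simp add: power2_eq_square)
  also have "\<dots> \<le> 2 * (\<bar>Im z / 2\<bar> * 1)"
    by (intro mult_left_mono mult_mono abs_sin_x_le_abs_x) auto
  finally have cos: "1 - cos (Im z) \<le> \<bar>Im z\<bar>" by simp
  have "exp (Re z) * (1 - cos (Im z)) \<le> 1 * (1 - cos (Im z))"
    using assms by (intro mult_right_mono) auto
  moreover have "1 - exp (Re z) \<le> \<bar>Re z\<bar>"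
    using exp_ge_add_one_self[of "Re z"] by linarith
  ultimately show ?thesis
    using cos by (simp add: Re_exp algebra_simps)
qed

lemma Re_stable_exponent: "Re (stable_exponent \<alpha> \<beta> \<sigma> \<mu> t) = - (\<sigma> powr \<alpha> * \<bar>t\<bar> powr \<alpha>)"
  by (simp add: stable_exponent_def)

lemma Im_stable_exponent:
  "Im (stable_exponent \<alpha> \<beta> \<sigma> \<mu> t)
    = t * \<mu> + \<sigma> powr \<alpha> * \<bar>t\<bar> powr \<alpha> * (\<beta> * sgn t * stable_Phi \<alpha> t)"
  by (simp add: stable_exponent_def)

text \<open>\<open>\<delta> < 1\<close> handles the drift and \<open>\<delta> < \<alpha>\<close> the
  skewness term; the halving leaves room for the logarithm at \<open>\<alpha> = 1\<close>, a case
  that the summand 2 in the constant covers.\<close>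

lemma abs_Im_stable_exponent_le:
  fixes \<alpha> \<beta> \<sigma> \<mu> t :: real
  assumes "0 < \<alpha>" "\<bar>t\<bar> \<le> 1"
  defines "\<delta> \<equiv> min \<alpha> 1 / 2"
  shows "\<bar>Im (stable_exponent \<alpha> \<beta> \<sigma> \<mu> t)\<bar>
    \<le> (\<bar>\<mu>\<bar> + \<sigma> powr \<alpha> * (\<bar>\<beta>\<bar> * (\<bar>tan (pi * \<alpha> / 2)\<bar> + 2))) * \<bar>t\<bar> powr \<delta>"
proof (cases "t = 0")
  case True
  then show ?thesis by (simp add: Im_stable_exponent)
next
  case False
  have mono: "\<bar>t\<bar> powr b \<le> \<bar>t\<bar> powr a" if "a \<le> b" for a b
    using that assms(2) False by (intro powr_mono') auto
  have Phi: "\<bar>t\<bar> powr \<alpha> * \<bar>stable_Phi \<alpha> t\<bar> \<le> (\<bar>tan (pi * \<alpha> / 2)\<bar> + 2) * \<bar>t\<bar> powr \<delta>"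
  proof (cases "\<alpha> = 1")
    case True
    \<comment> \<open>\<open>ln y \<le> y - 1\<close> at \<open>y = |t| powr (-1/2)\<close> trades
      the logarithm for half a power.\<close>
    have "ln (\<bar>t\<bar> powr (- (1 / 2))) \<le> \<bar>t\<bar> powr (- (1 / 2)) - 1"
      using False by (intro ln_le_minus_one) auto
    then have "- ln \<bar>t\<bar> \<le> 2 * \<bar>t\<bar> powr (- (1 / 2))"
      using False by (simp add: ln_powr)
    moreover have "ln \<bar>t\<bar> \<le> 0" using assms(2) False by simp
    ultimately have "\<bar>ln \<bar>t\<bar>\<bar> \<le> 2 * \<bar>t\<bar> powr (- (1 / 2))" by linarith
    then have "\<bar>t\<bar> * \<bar>ln \<bar>t\<bar>\<bar> \<le> \<bar>t\<bar> powr 1 * (2 * \<bar>t\<bar> powr (- (1 / 2)))"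
      by (intro mult_mono) auto
    also have "\<dots> = 2 * \<bar>t\<bar> powr \<delta>"
    proof -
      have "\<bar>t\<bar> powr 1 * \<bar>t\<bar> powr (- (1 / 2)) = \<bar>t\<bar> powr (1 + - (1 / 2))"
        by (rule powr_add[symmetric])
      then show ?thesis using True by (simp only: \<delta>_def) simp
    qed
    finally have *: "\<bar>t\<bar> * \<bar>ln \<bar>t\<bar>\<bar> \<le> 2 * \<bar>t\<bar> powr \<delta>" .
    have "\<bar>t\<bar> powr \<alpha> * \<bar>stable_Phi \<alpha> t\<bar> = (2 / pi) * (\<bar>t\<bar> * \<bar>ln \<bar>t\<bar>\<bar>)"
      using True by (simp add: stable_Phi_def abs_mult)
    also have "\<dots> \<le> 1 * (2 * \<bar>t\<bar> powr \<delta>)"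
      using pi_gt3 by (intro mult_mono[OF _ *]) auto
    also have "\<dots> \<le> (\<bar>tan (pi * \<alpha> / 2)\<bar> + 2) * \<bar>t\<bar> powr \<delta>"
      unfolding mult_1 by (intro mult_right_mono) auto
    finally show ?thesis .
  next
    case False
    have "\<bar>t\<bar> powr \<alpha> * \<bar>tan (pi * \<alpha> / 2)\<bar> \<le> \<bar>t\<bar> powr \<delta> * (\<bar>tan (pi * \<alpha> / 2)\<bar> + 2)"
      using \<open>0 < \<alpha>\<close> by (intro mult_mono mono) (auto simp: \<delta>_def)
    then show ?thesis using False by (simp add: stable_Phi_def mult.commute)
  qed
  have "\<bar>Im (stable_exponent \<alpha> \<beta> \<sigma> \<mu> t)\<bar>
     \<le> \<bar>t * \<mu>\<bar> + \<bar>\<sigma> powr \<alpha> * \<bar>t\<bar> powr \<alpha> * (\<beta> * sgn t * stable_Phi \<alpha> t)\<bar>"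
    unfolding Im_stable_exponent by (rule abs_triangle_ineq)
  also have "\<dots> = \<bar>\<mu>\<bar> * \<bar>t\<bar> powr 1 + \<sigma> powr \<alpha> * (\<bar>\<beta>\<bar> * (\<bar>t\<bar> powr \<alpha> * \<bar>stable_Phi \<alpha> t\<bar>))"
    using False by (simp add: abs_mult abs_sgn_eq)
  also have "\<dots> \<le> \<bar>\<mu>\<bar> * \<bar>t\<bar> powr \<delta>
      + \<sigma> powr \<alpha> * (\<bar>\<beta>\<bar> * ((\<bar>tan (pi * \<alpha> / 2)\<bar> + 2) * \<bar>t\<bar> powr \<delta>))"
    using Phi by (intro add_mono mult_left_mono mono) (auto simp: \<delta>_def)
  also have "\<dots> = (\<bar>\<mu>\<bar> + \<sigma> powr \<alpha> * (\<bar>\<beta>\<bar> * (\<bar>tan (pi * \<alpha> / 2)\<bar> + 2))) * \<bar>t\<bar> powr \<delta>"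
    by (simp add: algebra_simps)
  finally show ?thesis .
qed

text \<open>For \<open>|t| \<le> 1\<close> the real and imaginary parts of the exponent are bounded
  separately; for larger \<open>|t|\<close> the left side is at most 2, which explains the summand 2
  in the constant.\<close>

lemma one_minus_Re_exp_stable_exponent_le:
  fixes \<alpha> \<beta> \<sigma> \<mu> t :: real
  assumes "0 < \<alpha>"
  shows "1 - Re (exp (stable_exponent \<alpha> \<beta> \<sigma> \<mu> t))
    \<le> (2 + \<sigma> powr \<alpha> + (\<bar>\<mu>\<bar> + \<sigma> powr \<alpha> * (\<bar>\<beta>\<bar> * (\<bar>tan (pi * \<alpha> / 2)\<bar> + 2))))
        * \<bar>t\<bar> powr (min \<alpha> 1 / 2)"
    (is "_ \<le> (2 + ?a + ?b) * ?p")
proof (cases "\<bar>t\<bar> \<le> 1")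
  case True
  have "\<bar>t\<bar> powr \<alpha> \<le> ?p"
    using True assms by (cases "t = 0") (auto intro!: powr_mono')
  then have "?a * \<bar>t\<bar> powr \<alpha> \<le> ?a * ?p" by (intro mult_left_mono) auto
  moreover have "1 - Re (exp (stable_exponent \<alpha> \<beta> \<sigma> \<mu> t))
     \<le> \<bar>Re (stable_exponent \<alpha> \<beta> \<sigma> \<mu> t)\<bar> + \<bar>Im (stable_exponent \<alpha> \<beta> \<sigma> \<mu> t)\<bar>"
    by (rule one_minus_Re_exp_le) (simp add: Re_stable_exponent)
  moreover have "\<bar>Re (stable_exponent \<alpha> \<beta> \<sigma> \<mu> t)\<bar> = ?a * \<bar>t\<bar> powr \<alpha>"
    by (simp add: Re_stable_exponent)
  moreover note abs_Im_stable_exponent_le[OF assms True, of \<beta> \<sigma> \<mu>]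
  moreover have "(2 + ?a + ?b) * ?p = 2 * ?p + ?a * ?p + ?b * ?p" by (simp add: algebra_simps)
  moreover have "0 \<le> 2 * ?p" by simp
  ultimately show ?thesis by linarith
next
  case False
  have "- Re (exp (stable_exponent \<alpha> \<beta> \<sigma> \<mu> t)) \<le> cmod (exp (stable_exponent \<alpha> \<beta> \<sigma> \<mu> t))"
    using abs_Re_le_cmod[of "exp (stable_exponent \<alpha> \<beta> \<sigma> \<mu> t)"] by linarith
  also have "\<dots> \<le> 1" by (simp add: Re_stable_exponent)
  finally have "1 - Re (exp (stable_exponent \<alpha> \<beta> \<sigma> \<mu> t)) \<le> 2 * 1" by simp
  also have "\<dots> \<le> (2 + ?a + ?b) * ?p"
    using False assms by (intro mult_mono ge_one_powr_ge_zero) auto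
  finally show ?thesis .
qed

text \<open>Stability: multiplying the exponent by \<open>a powr \<alpha>\<close> amounts to scaling
  space by \<open>a\<close>, up to a drift \<open>b\<close>. This makes the increments affine images
  of one law.\<close>

lemma stable_exponent_rescale:
  fixes \<alpha> \<beta> \<sigma> \<mu> a :: real
  assumes "0 < a"
  obtains b where
    "\<And>\<omega>. complex_of_real (a powr \<alpha>) * stable_exponent \<alpha> \<beta> \<sigma> \<mu> \<omega>
      = \<i> * complex_of_real (\<omega> * b) + stable_exponent \<alpha> \<beta> \<sigma> \<mu> (a * \<omega>)"
proof -
  \<comment> \<open>For \<open>\<alpha> \<noteq> 1\<close> only the location term fails to scale
    like \<open>a powr \<alpha>\<close>. For \<open>\<alpha> = 1\<close> it does scale so, and
    \<open>b\<close> comes from \<open>ln |a * \<omega>| = ln a + ln |\<omega>|\<close>.\<close>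
  define b where "b = (if \<alpha> \<noteq> 1 then (a powr \<alpha> - a) * \<mu> else \<sigma> powr 1 * a * \<beta> * (2 / pi) * ln a)"
  show ?thesis
  proof (rule that[of b])
    fix \<omega>
    have abs: "\<bar>a * \<omega>\<bar> powr \<alpha> = a powr \<alpha> * \<bar>\<omega>\<bar> powr \<alpha>" and sgn: "sgn (a * \<omega>) = sgn \<omega>"
      using assms by (simp_all add: abs_mult powr_mult sgn_mult)
    have Phi: "a powr \<alpha> * \<bar>\<omega>\<bar> powr \<alpha> * (sgn \<omega> * stable_Phi \<alpha> (a * \<omega>))
      = a powr \<alpha> * \<bar>\<omega>\<bar> powr \<alpha> * (sgn \<omega> * stable_Phi \<alpha> \<omega>)
         - (if \<alpha> = 1 then a * \<omega> * (2 / pi) * ln a else 0)"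
    \<comment> \<open>The point \<open>\<omega> = 0\<close> is set apart because the logarithm does
      not split there; both sides are then 0.\<close>
    proof (cases "\<alpha> = 1 \<and> \<omega> \<noteq> 0")
      case True
      then have "ln \<bar>a * \<omega>\<bar> = ln a + ln \<bar>\<omega>\<bar>" using assms by (simp add: abs_mult ln_mult_pos)
      then have "stable_Phi \<alpha> (a * \<omega>) = stable_Phi \<alpha> \<omega> - (2 / pi) * ln a"
        using True by (simp add: stable_Phi_def algebra_simps)
      moreover have "\<bar>\<omega>\<bar> * sgn \<omega> = \<omega>" by (simp add: abs_mult_sgn)
      ultimately show ?thesis using True assms
        by (simp add: right_diff_distrib)
    qed (auto simp: stable_Phi_def)
    have "Im (\<i> * complex_of_real (\<omega> * b) + stable_exponent \<alpha> \<beta> \<sigma> \<mu> (a * \<omega>))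
      = \<omega> * b + a * \<omega> * \<mu>
         + \<sigma> powr \<alpha> * \<beta> * (a powr \<alpha> * \<bar>\<omega>\<bar> powr \<alpha> * (sgn \<omega> * stable_Phi \<alpha> (a * \<omega>)))"
      by (simp add: Im_stable_exponent abs sgn)
    also have "\<dots> = a powr \<alpha> * Im (stable_exponent \<alpha> \<beta> \<sigma> \<mu> \<omega>)"
      unfolding Phi Im_stable_exponent using assms by (simp add: b_def algebra_simps)
    finally have "Im (\<i> * complex_of_real (\<omega> * b) + stable_exponent \<alpha> \<beta> \<sigma> \<mu> (a * \<omega>))
      = a powr \<alpha> * Im (stable_exponent \<alpha> \<beta> \<sigma> \<mu> \<omega>)" .
    then show "complex_of_real (a powr \<alpha>) * stable_exponent \<alpha> \<beta> \<sigma> \<mu> \<omega>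
      = \<i> * complex_of_real (\<omega> * b) + stable_exponent \<alpha> \<beta> \<sigma> \<mu> (a * \<omega>)"
      by (intro complex_eqI) (simp_all add: Re_stable_exponent abs)
  qed
qed

section \<open>Decay and integrability of \<open>exp (- (c * |t| powr \<alpha>))\<close>\<close>

lemma integrable_inverse_one_plus_square: "integrable lborel (\<lambda>x::real. inverse (1 + x\<^sup>2))"
  using integrable_inverse_1_plus_square by (simp add: set_integrable_def)

text \<open>The factor \<open>max 1 |t|\<close> serves the integrability of \<open>char M t\<close>
  and of \<open>|t| * cmod (char M t)\<close> at once. For \<open>|t| > 1\<close> the exponential
  beats \<open>|t| ^ 3\<close>, which leaves a multiple of \<open>1 / t^2\<close>.\<close>

lemma max_exp_neg_powr_le:
  fixes \<alpha> c t :: real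
  assumes "0 < \<alpha>" "0 < c"
  shows "max 1 \<bar>t\<bar> * exp (- (c * \<bar>t\<bar> powr \<alpha>)) \<le> 2 * (1 + (3 / \<alpha> / c) powr (3 / \<alpha>)) * inverse (1 + t\<^sup>2)"
    (is "?l \<le> 2 * (1 + ?A) * _")
proof (cases "\<bar>t\<bar> \<le> 1")
  case True
  then have "t\<^sup>2 \<le> 1" by (simp add: abs_square_le_1)
  then have "1 \<le> 2 * inverse (1 + t\<^sup>2)" by (simp add: field_simps add_pos_nonneg)
  moreover have "?l \<le> 1" using True \<open>0 < c\<close> by (simp add: max_def)
  moreover have "0 \<le> 2 * ?A * inverse (1 + t\<^sup>2)" by (simp add: add_nonneg_nonneg)
  moreover have "2 * (1 + ?A) * inverse (1 + t\<^sup>2) = 2 * inverse (1 + t\<^sup>2) + 2 * ?A * inverse (1 + t\<^sup>2)"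
    by (simp add: algebra_simps)
  ultimately show ?thesis by linarith
next
  case False
  \<comment> \<open>With this \<open>k\<close>, raising \<open>y / k \<le> exp (y / k)\<close> to
    the power \<open>k\<close> puts a multiple of \<open>|t| ^ 3\<close> below
    \<open>exp y\<close>.\<close>
  define k where "k = 3 / \<alpha>"
  have k: "0 < k" "\<alpha> * k = 3" using assms by (auto simp: k_def)
  define y where "y = c * \<bar>t\<bar> powr \<alpha>"
  have y: "0 < y" using False assms by (auto simp: y_def)
  have "(y / k) powr k \<le> exp (y / k) powr k"
    using exp_ge_add_one_self[of "y / k"] k y by (intro powr_mono2) (simp_all del: exp_ge_add_one_self)
  also have "\<dots> = exp y" using k by (simp add: powr_def)
  finally have "exp (- y) \<le> inverse ((y / k) powr k)"
    using y k by (simp add: exp_minus le_imp_inverse_le)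
  also have "(y / k) powr k = (c / k) powr k * \<bar>t\<bar> powr 3"
    using k assms by (simp add: y_def powr_mult powr_powr powr_divide field_simps)
  also have "inverse \<dots> = (k / c) powr k * inverse (\<bar>t\<bar> ^ 3)"
    using False k assms by (simp add: powr_divide field_simps)
  finally have e: "exp (- y) \<le> (k / c) powr k * inverse (\<bar>t\<bar> ^ 3)" .
  have t: "1 \<le> t\<^sup>2" using False by (metis abs_ge_zero less_eq_real_def not_le one_le_power power2_abs)
  have "?l = \<bar>t\<bar> * exp (- y)" using False by (simp add: y_def max_def)
  also have "\<dots> \<le> \<bar>t\<bar> * ((k / c) powr k * inverse (\<bar>t\<bar> ^ 3))" by (intro mult_left_mono e) auto
  also have "\<dots> = (k / c) powr k * inverse (t\<^sup>2)"
    using False by (simp add: field_simps power2_eq_square power3_eq_cube)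
  also have "\<dots> \<le> (k / c) powr k * (2 * inverse (1 + t\<^sup>2))"
  proof (rule mult_left_mono)
    have "0 < t\<^sup>2" "0 < 1 + t\<^sup>2" using t by linarith+
    then show "inverse (t\<^sup>2) \<le> 2 * inverse (1 + t\<^sup>2)" using t by (simp add: inverse_eq_divide divide_simps)
  qed simp
  also have "\<dots> \<le> 2 * (1 + ?A) * inverse (1 + t\<^sup>2)"
    using t by (simp add: k_def field_simps add_pos_nonneg)
  finally show ?thesis .
qed

lemma integrable_max_exp_neg_powr:
  assumes "0 < \<alpha>" "0 < c"
  shows "integrable lborel (\<lambda>t::real. max 1 \<bar>t\<bar> * exp (- (c * \<bar>t\<bar> powr \<alpha>)))"
proof (rule Bochner_Integration.integrable_bound)
  show "integrable lborel (\<lambda>t::real. 2 * (1 + (3 / \<alpha> / c) powr (3 / \<alpha>)) * inverse (1 + t\<^sup>2))"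
    by (intro integrable_mult_right integrable_inverse_one_plus_square)
  show "AE t in lborel. norm (max 1 \<bar>t\<bar> * exp (- (c * \<bar>t\<bar> powr \<alpha>)))
      \<le> norm (2 * (1 + (3 / \<alpha> / c) powr (3 / \<alpha>)) * inverse (1 + t\<^sup>2))"
  proof (rule AE_I2)
    fix t :: real
    have "norm (max 1 \<bar>t\<bar> * exp (- (c * \<bar>t\<bar> powr \<alpha>))) = max 1 \<bar>t\<bar> * exp (- (c * \<bar>t\<bar> powr \<alpha>))"
      by simp
    also note max_exp_neg_powr_le[OF assms, of t]
    also have "2 * (1 + (3 / \<alpha> / c) powr (3 / \<alpha>)) * inverse (1 + t\<^sup>2)
      \<le> norm (2 * (1 + (3 / \<alpha> / c) powr (3 / \<alpha>)) * inverse (1 + t\<^sup>2))" by simp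
    finally show "norm (max 1 \<bar>t\<bar> * exp (- (c * \<bar>t\<bar> powr \<alpha>)))
      \<le> norm (2 * (1 + (3 / \<alpha> / c) powr (3 / \<alpha>)) * inverse (1 + t\<^sup>2))" .
  qed
qed measurable

section \<open>Entropy of binned densities\<close>

definition entropy_fun :: "real \<Rightarrow> real" where
  "entropy_fun u = - u * ln u"

lemma entropy_fun_measurable [measurable]: "entropy_fun \<in> borel_measurable borel"
  unfolding entropy_fun_def[abs_def] by measurable

lemma entropy_fun_nonneg:
  assumes "0 \<le> u" "u \<le> 1"
  shows "0 \<le> entropy_fun u"
  using assms by (cases "u = 0") (auto simp: entropy_fun_def intro!: mult_nonneg_nonpos)

text \<open>\<open>ln v \<le> v - 1\<close> at \<open>v = exp (- l) / u\<close> gives the upper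
  bound, and at \<open>v = u\<close> the lower one. The free \<open>l\<close> will be
  \<open>ln (1 + x^2)\<close>, which makes \<open>exp (- l)\<close> integrable in
  \<open>x\<close>.\<close>

lemma abs_entropy_fun_le:
  assumes "0 \<le> u" "u \<le> B" "1 \<le> B" "0 \<le> l"
  shows "\<bar>entropy_fun u\<bar> \<le> exp (- l) + (l + B) * u"
proof (cases "u = 0")
  case False
  with assms have u: "0 < u" by simp
  have "ln (exp (- l) / u) \<le> exp (- l) / u - 1"
    using u by (intro ln_le_minus_one) simp
  then have "- l - ln u \<le> exp (- l) / u - 1"
    using u by (simp add: ln_div)
  then have "u * (- l - ln u) \<le> u * (exp (- l) / u - 1)"
    using u by (intro mult_left_mono) auto
  then have "- u * ln u \<le> exp (- l) + l * u - u"
    using u by (simp add: algebra_simps)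
  moreover have "0 \<le> B * u" using assms by simp
  moreover have "(l + B) * u = l * u + B * u" by (simp add: algebra_simps)
  ultimately have 1: "entropy_fun u \<le> exp (- l) + (l + B) * u"
    using u by (simp add: entropy_fun_def)
  have "ln u \<le> u - 1" using u by (rule ln_le_minus_one)
  then have "u * ln u \<le> u * B" using u assms by (intro mult_left_mono) auto
  moreover have "0 \<le> l * u" "0 < exp (- l)" using assms by auto
  ultimately have 2: "- entropy_fun u \<le> exp (- l) + (l + B) * u"
    using mult.commute[of u B] unfolding entropy_fun_def \<open>(l + B) * u = l * u + B * u\<close> by linarith
  from 1 2 show ?thesis by (simp add: abs_le_iff)
qed (simp add: entropy_fun_def)

text \<open>At 0 this is the limit \<open>u * ln u \<rightarrow> 0\<close>. Uniform continuity on
  the compact interval will carry uniform closeness of densities over to entropies.\<close>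

lemma continuous_on_entropy_fun: "continuous_on {0..B} entropy_fun"
proof (rule continuous_on_subset)
  show "continuous_on {0..} entropy_fun"
    unfolding continuous_on_eq_continuous_within
  proof
    fix x :: real assume "x \<in> {0..}"
    show "continuous (at x within {0..}) entropy_fun"
    proof (cases "x = 0")
      case True
      have "((\<lambda>u::real. - u * ln u) \<longlongrightarrow> 0) (at_right 0)" by real_asymp
      then show ?thesis
        by (simp add: True continuous_within entropy_fun_def[abs_def] at_within_Ici_at_right)
    next
      case False
      then show ?thesis
        unfolding entropy_fun_def[abs_def] by (intro continuous_intros) auto
    qed
  qed
qed auto

text \<open>The cost of replacing a point by the grid point of its cell: expanding the squares gives
  \<open>1 + x^2 \<le> 3 * (1 + y^2)\<close>, and \<open>ln 3 \<le> 2\<close>.\<close>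

lemma ln_one_plus_square_shift:
  fixes x y :: real
  assumes "\<bar>x - y\<bar> \<le> 1"
  shows "ln (1 + x\<^sup>2) \<le> ln (1 + y\<^sup>2) + 2"
proof -
  have "(x - y)\<^sup>2 \<le> 1" using assms by (simp add: abs_square_le_1)
  moreover have "0 \<le> (x - 2 * y)\<^sup>2" "0 \<le> y\<^sup>2" by simp_all
  ultimately have "1 + x\<^sup>2 \<le> 3 * (1 + y\<^sup>2)"
  proof -
    have "(x - y)\<^sup>2 = x\<^sup>2 + y\<^sup>2 - 2 * (x * y)" "(x - 2 * y)\<^sup>2 = x\<^sup>2 + 4 * y\<^sup>2 - 4 * (x * y)"
      by (simp_all add: power2_eq_square algebra_simps)
    moreover assume "(x - y)\<^sup>2 \<le> 1" "0 \<le> (x - 2 * y)\<^sup>2" "0 \<le> y\<^sup>2"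
    ultimately show ?thesis unfolding distrib_left by linarith
  qed
  moreover have pos: "0 < 1 + x\<^sup>2" "0 < 1 + y\<^sup>2" by (simp_all add: add_pos_nonneg)
  ultimately have "ln (1 + x\<^sup>2) \<le> ln (3 * (1 + y\<^sup>2))" by simp
  also have "\<dots> = ln 3 + ln (1 + y\<^sup>2)" using pos by (intro ln_mult_pos) auto
  also have "ln 3 \<le> (2::real)" using ln_le_minus_one[of 3] by simp
  finally show ?thesis by simp
qed

section \<open>Cells of width \<open>1 / s\<close> with offset \<open>c\<close>, and functions
  constant on cells\<close>

definition bin :: "real \<Rightarrow> real \<Rightarrow> real \<Rightarrow> int" where
  "bin s c x = \<lfloor>c + s * x\<rfloor>"

lemma bin_measurable [measurable]: "bin s c \<in> borel \<rightarrow>\<^sub>M count_space UNIV"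
  unfolding bin_def by measurable

lemma bin_eq_iff:
  assumes "0 < s"
  shows "bin s c x = k \<longleftrightarrow> x \<in> {(k - c) / s..<(k + 1 - c) / s}"
  using assms by (auto simp: bin_def floor_eq_iff field_simps)

lemma bin_vimage:
  assumes "0 < s"
  shows "{x. bin s c x = k} = {(k - c) / s..<(k + 1 - c) / s}"
  using bin_eq_iff[OF assms] by auto

text \<open>Every cell has length \<open>1 / s\<close>; this turns Lebesgue integrals of functions
  constant on cells into sums over the integers.\<close>

lemma distr_lborel_bin:
  assumes "0 < s"
  shows "distr lborel (count_space UNIV) (bin s c) = density (count_space UNIV) (\<lambda>_. ennreal (1 / s))"
proof (rule measure_eqI_countable[where A = UNIV])
  fix k :: int
  have "emeasure (distr lborel (count_space UNIV) (bin s c)) {k} = emeasure lborel {x. bin s c x = k}"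
    by (subst emeasure_distr) (auto simp: vimage_def)
  also have "\<dots> = ennreal (1 / s)"
    unfolding bin_vimage[OF assms] using assms
    by (subst emeasure_lborel_Ico) (auto simp: field_simps divide_right_mono)
  finally show "emeasure (distr lborel (count_space UNIV) (bin s c)) {k}
      = emeasure (density (count_space UNIV) (\<lambda>_. ennreal (1 / s))) {k}"
    by (simp add: emeasure_density nn_integral_cmult)
qed auto

lemma
  fixes F :: "int \<Rightarrow> real"
  assumes s: "0 < s"
  shows integrable_lborel_bin:
      "integrable lborel (\<lambda>x. F (bin s c x)) \<longleftrightarrow> integrable (count_space UNIV) F"
    and integral_lborel_bin:
      "(LBINT x. F (bin s c x)) = (1 / s) * (\<integral>k. F k \<partial>count_space UNIV)"
proof -
  have "integrable lborel (\<lambda>x. F (bin s c x)) \<longleftrightarrow> integrable (distr lborel (count_space UNIV) (bin s c)) F"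
    by (subst integrable_distr_eq) auto
  also have "\<dots> \<longleftrightarrow> integrable (count_space UNIV) (\<lambda>k. (1 / s) * F k)"
    unfolding distr_lborel_bin[OF s] using s by (subst integrable_density) auto
  finally show "integrable lborel (\<lambda>x. F (bin s c x)) \<longleftrightarrow> integrable (count_space UNIV) F"
    using s by (simp only: integrable_mult_left_iff) simp
  have "(LBINT x. F (bin s c x)) = (\<integral>k. F k \<partial>distr lborel (count_space UNIV) (bin s c))"
    by (subst integral_distr) auto
  also have "\<dots> = (\<integral>k. (1 / s) * F k \<partial>count_space UNIV)"
    unfolding distr_lborel_bin[OF s] using s by (subst integral_density) auto
  finally show "(LBINT x. F (bin s c x)) = (1 / s) * (\<integral>k. F k \<partial>count_space UNIV)"
    by simp
qed

context real_distribution
begin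

lemma distr_bin:
  "distr M (count_space UNIV) (bin s c)
    = density (count_space UNIV) (\<lambda>k. ennreal (measure M {x. bin s c x = k}))"
proof (rule measure_eqI_countable[where A = UNIV])
  fix k :: int
  have "emeasure (distr M (count_space UNIV) (bin s c)) {k} = emeasure M {x. bin s c x = k}"
    by (subst emeasure_distr) (auto simp: vimage_def)
  then show "emeasure (distr M (count_space UNIV) (bin s c)) {k}
      = emeasure (density (count_space UNIV) (\<lambda>k. ennreal (measure M {x. bin s c x = k}))) {k}"
    by (simp add: emeasure_density emeasure_eq_measure nn_integral_count_space_indicator)
qed auto

lemma
  fixes F :: "int \<Rightarrow> real"
  shows integrable_bin:
      "integrable M (\<lambda>x. F (bin s c x))
        \<longleftrightarrow> integrable (count_space UNIV) (\<lambda>k. measure M {x. bin s c x = k} * F k)"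
    and integral_bin:
      "(\<integral>x. F (bin s c x) \<partial>M) = (\<integral>k. measure M {x. bin s c x = k} * F k \<partial>count_space UNIV)"
proof -
  have "integrable M (\<lambda>x. F (bin s c x)) \<longleftrightarrow> integrable (distr M (count_space UNIV) (bin s c)) F"
    by (subst integrable_distr_eq) auto
  also have "\<dots> \<longleftrightarrow> integrable (count_space UNIV) (\<lambda>k. measure M {x. bin s c x = k} * F k)"
    unfolding distr_bin by (subst integrable_density) auto
  finally show "integrable M (\<lambda>x. F (bin s c x))
        \<longleftrightarrow> integrable (count_space UNIV) (\<lambda>k. measure M {x. bin s c x = k} * F k)" .
  have "(\<integral>x. F (bin s c x) \<partial>M) = (\<integral>k. F k \<partial>distr M (count_space UNIV) (bin s c))"
    by (subst integral_distr) auto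
  also have "\<dots> = (\<integral>k. measure M {x. bin s c x = k} * F k \<partial>count_space UNIV)"
    unfolding distr_bin by (subst integral_density) auto
  finally show "(\<integral>x. F (bin s c x) \<partial>M) = (\<integral>k. measure M {x. bin s c x = k} * F k \<partial>count_space UNIV)" .
qed

text \<open>Mass of the cell of \<open>x\<close> divided by its length \<open>1 / s\<close>: if
  \<open>M\<close> has a density, its average over that cell.\<close>

definition binned_density :: "real \<Rightarrow> real \<Rightarrow> real \<Rightarrow> real" where
  "binned_density s c x = s * measure M {y. bin s c y = bin s c x}"

lemma binned_density_measurable [measurable]: "binned_density s c \<in> borel_measurable borel"
proof -
  have "(\<lambda>x. (\<lambda>k. s * measure M {y. bin s c y = k}) (bin s c x)) \<in> borel_measurable borel"
    by (rule measurable_compose[OF bin_measurable]) auto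
  then show ?thesis by (simp add: binned_density_def[abs_def])
qed

lemma binned_density_nonneg: "0 \<le> s \<Longrightarrow> 0 \<le> binned_density s c x"
  by (simp add: binned_density_def)

text \<open>Both integrals reduce to the same sum over cells, so a weight constant on cells can be
  moved between the binned density and \<open>M\<close>.\<close>

lemma
  fixes G :: "int \<Rightarrow> real"
  assumes s: "0 < s"
  shows integrable_binned_density:
      "integrable lborel (\<lambda>x. G (bin s c x) * binned_density s c x) \<longleftrightarrow> integrable M (\<lambda>x. G (bin s c x))"
    and integral_binned_density:
      "(LBINT x. G (bin s c x) * binned_density s c x) = (\<integral>x. G (bin s c x) \<partial>M)"
proof -
  let ?H = "\<lambda>k. G k * (s * measure M {y. bin s c y = k})"
  have H: "?H = (\<lambda>k. s * (measure M {y. bin s c y = k} * G k))" by (simp add: mult_ac)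
  show "integrable lborel (\<lambda>x. G (bin s c x) * binned_density s c x) \<longleftrightarrow> integrable M (\<lambda>x. G (bin s c x))"
    unfolding binned_density_def integrable_lborel_bin[OF s, of ?H] integrable_bin H using s by simp
  show "(LBINT x. G (bin s c x) * binned_density s c x) = (\<integral>x. G (bin s c x) \<partial>M)"
    unfolding binned_density_def integral_lborel_bin[OF s, of ?H] integral_bin H using s by simp
qed

end

lemma integrable_indicator_mult:
  fixes f :: "real \<Rightarrow> real"
  assumes "integrable N f" "{x. R < \<bar>x\<bar>} \<in> sets N"
  shows "integrable N (\<lambda>x. indicator {x. R < \<bar>x\<bar>} x * f x)"
  using integrable_mult_indicator[OF assms(2,1)] by simp

lemma abs_greater_in_borel [measurable]: "{x::real. R < \<bar>x\<bar>} \<in> sets borel"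
  by measurable

lemma
  assumes s: "0 < s"
  shows integrable_indicator_bin: "integrable lborel (indicator {x. bin s c x = k} :: real \<Rightarrow> real)"
    and integral_indicator_bin: "(LBINT x. indicator {x. bin s c x = k} x) = 1 / s"
  unfolding bin_vimage[OF s] using s
  by (auto simp: divide_right_mono field_simps)

section \<open>Entropy under binning for bounded Lipschitz densities with a logarithmic
  moment\<close>

locale lipschitz_density = real_distribution M for M :: "real measure" +
  fixes p :: "real \<Rightarrow> real" and B K :: real
  assumes p_measurable [measurable]: "p \<in> borel_measurable borel"
    and p_nonneg: "0 \<le> p x"
    and p_le: "p x \<le> B"
    and B_ge_1: "1 \<le> B"
    and p_lipschitz: "\<bar>p x - p y\<bar> \<le> K * \<bar>x - y\<bar>"
    and M_eq: "M = density lborel p"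
    and integrable_log: "integrable M (\<lambda>x. ln (1 + x\<^sup>2))"
begin

lemma K_nonneg: "0 \<le> K"
  using p_lipschitz[of 0 1] by simp

lemma measure_bin_eq:
  assumes "0 < s"
  shows "integrable lborel (\<lambda>x. indicator {x. bin s c x = k} x * p x)"
    and "measure M {x. bin s c x = k} = (LBINT x. indicator {x. bin s c x = k} x * p x)"
proof -
  show int: "integrable lborel (\<lambda>x. indicator {x. bin s c x = k} x * p x)"
    unfolding bin_vimage[OF assms]
    by (rule integrableI_bounded_set[where A = "{(k - c) / s..<(k + 1 - c) / s}" and B = B])
      (use assms in \<open>auto simp: p_nonneg p_le divide_right_mono\<close>)
  have "emeasure M {x. bin s c x = k} = (\<integral>\<^sup>+ x. ennreal (p x) * indicator {x. bin s c x = k} x \<partial>lborel)"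
    unfolding bin_vimage[OF assms] by (subst M_eq, rule emeasure_density) auto
  also have "\<dots> = (\<integral>\<^sup>+ x. ennreal (indicator {x. bin s c x = k} x * p x) \<partial>lborel)"
    by (intro nn_integral_cong) (auto split: split_indicator)
  also have "\<dots> = ennreal (LBINT x. indicator {x. bin s c x = k} x * p x)"
    by (rule nn_integral_eq_integral[OF int]) (auto simp: p_nonneg)
  finally show "measure M {x. bin s c x = k} = (LBINT x. indicator {x. bin s c x = k} x * p x)"
    by (auto simp: measure_def p_nonneg intro!: integral_nonneg_AE)
qed

lemma binned_density_le:
  assumes s: "0 < s"
  shows "binned_density s c x \<le> B"
proof -
  let ?I = "{y. bin s c y = bin s c x}"
  have "measure M ?I \<le> (LBINT y. indicator ?I y * B)"
    unfolding measure_bin_eq[OF s]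
    by (intro integral_mono measure_bin_eq[OF s] integrable_mult_left integrable_indicator_bin[OF s])
      (auto simp: p_le split: split_indicator)
  also have "\<dots> = B / s" using integral_indicator_bin[OF s] by simp
  finally show ?thesis using s by (simp add: binned_density_def field_simps)
qed

text \<open>Points of one cell are within \<open>1 / s\<close> of each other, and averaging
  preserves the Lipschitz bound. The estimate is free of \<open>c\<close>, hence uniform over
  translated grids.\<close>

lemma abs_binned_density_diff_le:
  assumes s: "0 < s"
  shows "\<bar>binned_density s c x - p x\<bar> \<le> K / s"
proof -
  let ?I = "{y. bin s c y = bin s c x}"
  note int = integrable_indicator_bin[OF s, of c "bin s c x"]
  have near: "\<bar>y - x\<bar> \<le> 1 / s" if "y \<in> ?I" for y
  proof -
    have "y \<in> {(bin s c x - c) / s..<(bin s c x + 1 - c) / s}"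
      "x \<in> {(bin s c x - c) / s..<(bin s c x + 1 - c) / s}"
      using that bin_eq_iff[OF s] by blast+
    moreover have "(bin s c x + 1 - c) / s = (bin s c x - c) / s + 1 / s"
      by (simp add: add_divide_distrib diff_divide_distrib)
    ultimately show ?thesis by auto
  qed
  have "measure M ?I - p x / s = (LBINT y. indicator ?I y * p y) - (LBINT y. indicator ?I y * p x)"
    using integral_indicator_bin[OF s] measure_bin_eq(2)[OF s] by simp
  also have "\<dots> = (LBINT y. indicator ?I y * p y - indicator ?I y * p x)"
    by (intro Bochner_Integration.integral_diff[symmetric] measure_bin_eq[OF s] integrable_mult_left int)
  finally have eq: "measure M ?I - p x / s = (LBINT y. indicator ?I y * p y - indicator ?I y * p x)" .
  have "\<bar>measure M ?I - p x / s\<bar> \<le> (LBINT y. \<bar>indicator ?I y * p y - indicator ?I y * p x\<bar>)"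
    unfolding eq by (rule integral_abs_bound)
  also have "\<dots> \<le> (LBINT y. indicator ?I y * (K * (1 / s)))"
  proof (rule integral_mono)
    fix y
    show "\<bar>indicator ?I y * p y - indicator ?I y * p x\<bar> \<le> indicator ?I y * (K * (1 / s))"
    proof (cases "y \<in> ?I")
      case True
      have "\<bar>p y - p x\<bar> \<le> K * \<bar>y - x\<bar>" by (rule p_lipschitz)
      also have "\<dots> \<le> K * (1 / s)" using near[OF True] K_nonneg by (intro mult_left_mono)
      finally show ?thesis using True by simp
    qed simp
  qed (intro integrable_abs Bochner_Integration.integrable_diff measure_bin_eq[OF s] integrable_mult_left int)+
  also have "\<dots> = (K / s) / s" using integral_indicator_bin[OF s] by simp
  finally have *: "\<bar>measure M ?I - p x / s\<bar> \<le> (K / s) / s" .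
  have "\<bar>binned_density s c x - p x\<bar> = \<bar>s * (measure M ?I - p x / s)\<bar>"
    using s by (simp add: binned_density_def right_diff_distrib)
  also have "\<dots> = s * \<bar>measure M ?I - p x / s\<bar>"
    using s by (simp add: abs_mult)
  also have "\<dots> \<le> s * ((K / s) / s)" using * s by (intro mult_left_mono) auto
  finally show ?thesis using s by simp
qed

text \<open>A common majorant for the entropy tails of \<open>p\<close> and of its binned versions
  with \<open>1 \<le> s\<close>. The slack in \<open>R - 2\<close> and in the summand 4 pays for two
  moves between a point and the grid point of its cell, each costing 1 in position and 2 in the
  logarithm.\<close>

definition tail_bound :: "real \<Rightarrow> real" where
  "tail_bound R = (LBINT x. indicator {x. R < \<bar>x\<bar>} x * inverse (1 + x\<^sup>2))
     + (\<integral>x. indicator {x. R - 2 < \<bar>x\<bar>} x * (ln (1 + x\<^sup>2) + 4 + B) \<partial>M)"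

lemma integrable_M_log_plus: "integrable M (\<lambda>x. ln (1 + x\<^sup>2) + C)"
  using integrable_log by auto

lemma tail_bound_tendsto_0: "(\<lambda>n. tail_bound (real n)) \<longlonglongrightarrow> 0"
proof -
  have ev: "(\<lambda>n. indicator {x. real n - a < \<bar>x\<bar>} x * f) \<longlonglongrightarrow> 0" for a x f :: real
  proof (rule tendsto_eventually)
    show "eventually (\<lambda>n. indicator {x. real n - a < \<bar>x\<bar>} x * f = 0) sequentially"
      using eventually_ge_at_top[of "nat \<lceil>\<bar>x\<bar> + a\<rceil>"]
    proof eventually_elim
      case (elim n)
      then have "\<bar>x\<bar> + a \<le> real n" by linarith
      then show ?case by simp
    qed
  qed
  have "(\<lambda>n. LBINT x. indicator {x. real n < \<bar>x\<bar>} x * inverse (1 + x\<^sup>2)) \<longlonglongrightarrow> (LBINT x::real. 0)"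
    by (rule integral_dominated_convergence[OF _ _ integrable_inverse_one_plus_square])
      (use ev[of 0] in \<open>auto simp: indicator_def\<close>)
  moreover have "(\<lambda>n. \<integral>x. indicator {x. real n - 2 < \<bar>x\<bar>} x * (ln (1 + x\<^sup>2) + 4 + B) \<partial>M) \<longlonglongrightarrow> (\<integral>x. 0 \<partial>M)"
  proof (rule integral_dominated_convergence)
    show "integrable M (\<lambda>x. ln (1 + x\<^sup>2) + (4 + B))" by (rule integrable_M_log_plus)
    show "AE x in M. norm (indicator {x. real n - 2 < \<bar>x\<bar>} x * (ln (1 + x\<^sup>2) + 4 + B)) \<le> ln (1 + x\<^sup>2) + (4 + B)" for n
      using B_ge_1 by (intro AE_I2) (auto simp: indicator_def)
  qed (use ev in auto)
  ultimately have "(\<lambda>n. tail_bound (real n)) \<longlonglongrightarrow> 0 + 0"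
    unfolding tail_bound_def by (intro tendsto_add) simp_all
  then show ?thesis by simp
qed

text \<open>Taking \<open>l = ln (1 + x^2)\<close> in \<open>abs_entropy_fun_le\<close> gives an
  integrable majorant. The general \<open>u\<close> serves both \<open>p\<close> and the binned
  densities.\<close>

lemma entropy_tail_le:
  fixes u :: "real \<Rightarrow> real"
  assumes [measurable]: "u \<in> borel_measurable borel"
    and u: "\<And>x. 0 \<le> u x" "\<And>x. u x \<le> B"
    and int: "integrable lborel (\<lambda>x. (ln (1 + x\<^sup>2) + B) * u x)"
    and tail: "(LBINT x. indicator {x. R < \<bar>x\<bar>} x * ((ln (1 + x\<^sup>2) + B) * u x))
      \<le> (\<integral>x. indicator {x. R - 2 < \<bar>x\<bar>} x * (ln (1 + x\<^sup>2) + 4 + B) \<partial>M)"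
  shows "integrable lborel (\<lambda>x. entropy_fun (u x))"
    and "(LBINT x. indicator {x. R < \<bar>x\<bar>} x * \<bar>entropy_fun (u x)\<bar>) \<le> tail_bound R"
proof -
  have bound: "\<bar>entropy_fun (u x)\<bar> \<le> inverse (1 + x\<^sup>2) + (ln (1 + x\<^sup>2) + B) * u x" for x
  proof -
    have "0 < 1 + x\<^sup>2" by (simp add: add_pos_nonneg)
    then have "exp (- ln (1 + x\<^sup>2)) = inverse (1 + x\<^sup>2)" by (simp add: exp_minus)
    then show ?thesis
      using abs_entropy_fun_le[OF u(1)[of x] u(2)[of x] B_ge_1, of "ln (1 + x\<^sup>2)"] by simp
  qed
  note int' = Bochner_Integration.integrable_add[OF integrable_inverse_one_plus_square int]
  show int_e: "integrable lborel (\<lambda>x. entropy_fun (u x))"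
    by (rule Bochner_Integration.integrable_bound[OF int'])
      (auto intro!: AE_I2 order_trans[OF bound])
  have "(LBINT x. indicator {x. R < \<bar>x\<bar>} x * \<bar>entropy_fun (u x)\<bar>)
    \<le> (LBINT x. indicator {x. R < \<bar>x\<bar>} x * inverse (1 + x\<^sup>2)
         + indicator {x. R < \<bar>x\<bar>} x * ((ln (1 + x\<^sup>2) + B) * u x))"
    using bound
    by (intro integral_mono Bochner_Integration.integrable_add integrable_indicator_mult
        integrable_abs int_e int integrable_inverse_one_plus_square) (auto simp: indicator_def)
  also have "\<dots> = (LBINT x. indicator {x. R < \<bar>x\<bar>} x * inverse (1 + x\<^sup>2))
     + (LBINT x. indicator {x. R < \<bar>x\<bar>} x * ((ln (1 + x\<^sup>2) + B) * u x))"
    by (intro Bochner_Integration.integral_add integrable_indicator_mult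
        int integrable_inverse_one_plus_square) auto
  also have "\<dots> \<le> tail_bound R"
    unfolding tail_bound_def using tail by simp
  finally show "(LBINT x. indicator {x. R < \<bar>x\<bar>} x * \<bar>entropy_fun (u x)\<bar>) \<le> tail_bound R" .
qed

lemma
  shows integrable_entropy_density: "integrable lborel (\<lambda>x. entropy_fun (p x))"
    and entropy_density_tail: "(LBINT x. indicator {x. R < \<bar>x\<bar>} x * \<bar>entropy_fun (p x)\<bar>) \<le> tail_bound R"
proof -
  have int: "integrable lborel (\<lambda>x. (ln (1 + x\<^sup>2) + B) * p x)"
    using integrable_M_log_plus[of B]
    by (subst (asm) M_eq, subst (asm) integrable_density) (auto simp: p_nonneg mult.commute)
  have "(LBINT x. indicator {x. R < \<bar>x\<bar>} x * ((ln (1 + x\<^sup>2) + B) * p x))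
     = (\<integral>x. indicator {x. R < \<bar>x\<bar>} x * (ln (1 + x\<^sup>2) + B) \<partial>M)"
    by (subst M_eq, subst integral_density) (auto simp: p_nonneg mult_ac)
  also have "\<dots> \<le> (\<integral>x. indicator {x. R - 2 < \<bar>x\<bar>} x * (ln (1 + x\<^sup>2) + (4 + B)) \<partial>M)"
    using B_ge_1
    by (intro integral_mono integrable_indicator_mult integrable_M_log_plus) (auto simp: indicator_def)
  finally have tail: "(LBINT x. indicator {x. R < \<bar>x\<bar>} x * ((ln (1 + x\<^sup>2) + B) * p x))
      \<le> (\<integral>x. indicator {x. R - 2 < \<bar>x\<bar>} x * (ln (1 + x\<^sup>2) + 4 + B) \<partial>M)"
    by (simp add: add.assoc)
  note * = entropy_tail_le[OF p_measurable p_nonneg p_le int this]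
  show "integrable lborel (\<lambda>x. entropy_fun (p x))" by (rule *)
  show "(LBINT x. indicator {x. R < \<bar>x\<bar>} x * \<bar>entropy_fun (p x)\<bar>) \<le> tail_bound R" by (rule *)
qed

text \<open>The logarithmic weight is enlarged to one constant on cells, so that the binned density
  can be exchanged for \<open>M\<close>; afterwards the weight is compared with a function of
  \<open>x\<close> again.\<close>

lemma
  assumes s: "1 \<le> s"
  shows integrable_entropy_binned: "integrable lborel (\<lambda>x. entropy_fun (binned_density s c x))"
    and entropy_binned_tail:
      "(LBINT x. indicator {x. R < \<bar>x\<bar>} x * \<bar>entropy_fun (binned_density s c x)\<bar>) \<le> tail_bound R"
proof -
  have s0: "0 < s" using s by simp
  \<comment> \<open>Left end of cell \<open>k\<close>; \<open>1 \<le> s\<close> keeps it within 1 of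
    every point of the cell.\<close>
  define r where "r k = (real_of_int k - c) / s" for k
  have r: "\<bar>r (bin s c x) - x\<bar> \<le> 1" for x
  proof -
    have "\<bar>r (bin s c x) - x\<bar> = \<bar>real_of_int (bin s c x) - (c + s * x)\<bar> / s"
      using s0 by (simp add: r_def field_simps abs_if)
    also have "\<dots> \<le> 1 / s"
      unfolding bin_def using s0 by (intro divide_right_mono) linarith+
    also have "\<dots> \<le> 1" using s by simp
    finally show ?thesis .
  qed
  define G where "G k = ln (1 + (r k)\<^sup>2) + 2 + B" for k
  \<comment> \<open>The cutoff lies halfway: \<open>R < |x|\<close> forces
    \<open>R - 1 < |r (bin s c x)|\<close>, which in turn forces \<open>R - 2 < |x|\<close>.\<close>
  define GR where "GR k = indicator {x. R - 1 < \<bar>x\<bar>} (r k) * G k" for k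
  have G1: "ln (1 + x\<^sup>2) + B \<le> G (bin s c x)" and G2: "G (bin s c x) \<le> ln (1 + x\<^sup>2) + (4 + B)" for x
    using ln_one_plus_square_shift[of x "r (bin s c x)"] ln_one_plus_square_shift[of "r (bin s c x)" x]
      r[of x] by (auto simp: G_def abs_minus_commute)
  have G0: "0 \<le> ln (1 + x\<^sup>2) + B" for x :: real using B_ge_1 by simp
  have G0': "0 \<le> G k" for k using B_ge_1 by (simp add: G_def)
  have [measurable]: "(\<lambda>x. G (bin s c x)) \<in> borel_measurable borel" "(\<lambda>x. GR (bin s c x)) \<in> borel_measurable borel"
    by (rule measurable_compose[OF bin_measurable], simp)+
  have intG: "integrable M (\<lambda>x. G (bin s c x))"
    by (rule Bochner_Integration.integrable_bound[OF integrable_M_log_plus[of "4 + B"]])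
      (use G2 G0' in \<open>auto intro!: AE_I2 order_trans[OF G2]\<close>)
  have intGR: "integrable M (\<lambda>x. GR (bin s c x))"
    by (rule Bochner_Integration.integrable_bound[OF intG])
      (auto simp: GR_def indicator_def)
  have q0: "0 \<le> binned_density s c x" for x using s0 by (intro binned_density_nonneg) simp
  have int: "integrable lborel (\<lambda>x. (ln (1 + x\<^sup>2) + B) * binned_density s c x)"
  proof (rule Bochner_Integration.integrable_bound)
    show "integrable lborel (\<lambda>x. G (bin s c x) * binned_density s c x)"
      using integrable_binned_density[OF s0] intG by blast
    show "AE x in lborel. norm ((ln (1 + x\<^sup>2) + B) * binned_density s c x)
        \<le> norm (G (bin s c x) * binned_density s c x)"
      by (rule AE_I2, unfold real_norm_def abs_mult)
        (intro mult_right_mono, use G1 G0 G0' in auto)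
  qed measurable
  have "(LBINT x. indicator {x. R < \<bar>x\<bar>} x * ((ln (1 + x\<^sup>2) + B) * binned_density s c x))
     \<le> (LBINT x. GR (bin s c x) * binned_density s c x)"
  proof (rule integral_mono)
    show "integrable lborel (\<lambda>x. GR (bin s c x) * binned_density s c x)"
      using integrable_binned_density[OF s0] intGR by blast
    show "integrable lborel (\<lambda>x. indicator {x. R < \<bar>x\<bar>} x * ((ln (1 + x\<^sup>2) + B) * binned_density s c x))"
      by (intro integrable_indicator_mult int) simp
    fix x
    show "indicator {x. R < \<bar>x\<bar>} x * ((ln (1 + x\<^sup>2) + B) * binned_density s c x)
       \<le> GR (bin s c x) * binned_density s c x"
    proof (cases "R < \<bar>x\<bar>")
      case True
      then have "R - 1 < \<bar>r (bin s c x)\<bar>" using r[of x] by linarith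
      then show ?thesis using True G1[of x] q0[of x] by (auto simp: GR_def intro!: mult_right_mono)
    next
      case False
      then show ?thesis using q0[of x] G0' by (simp add: GR_def)
    qed
  qed
  also have "\<dots> = (\<integral>x. GR (bin s c x) \<partial>M)"
    by (rule integral_binned_density[OF s0])
  also have "\<dots> \<le> (\<integral>x. indicator {x. R - 2 < \<bar>x\<bar>} x * (ln (1 + x\<^sup>2) + (4 + B)) \<partial>M)"
  proof (rule integral_mono)
    show "integrable M (\<lambda>x. indicator {x. R - 2 < \<bar>x\<bar>} x * (ln (1 + x\<^sup>2) + (4 + B)))"
      by (intro integrable_indicator_mult integrable_M_log_plus) simp
    fix x
    show "GR (bin s c x) \<le> indicator {x. R - 2 < \<bar>x\<bar>} x * (ln (1 + x\<^sup>2) + (4 + B))"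
    proof (cases "R - 1 < \<bar>r (bin s c x)\<bar>")
      case True
      then have "R - 2 < \<bar>x\<bar>" using r[of x] by linarith
      then show ?thesis using True G2[of x] by (simp add: GR_def)
    next
      case False
      then show ?thesis using G0[of x] by (auto simp: GR_def intro!: mult_nonneg_nonneg)
    qed
  qed (rule intGR)
  finally have tail: "(LBINT x. indicator {x. R < \<bar>x\<bar>} x * ((ln (1 + x\<^sup>2) + B) * binned_density s c x))
      \<le> (\<integral>x. indicator {x. R - 2 < \<bar>x\<bar>} x * (ln (1 + x\<^sup>2) + 4 + B) \<partial>M)"
    by (simp add: add.assoc)
  note * = entropy_tail_le[OF binned_density_measurable q0 binned_density_le[OF s0] int this]
  show "integrable lborel (\<lambda>x. entropy_fun (binned_density s c x))" by (rule *)
  show "(LBINT x. indicator {x. R < \<bar>x\<bar>} x * \<bar>entropy_fun (binned_density s c x)\<bar>) \<le> tail_bound R"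
    by (rule *)
qed

text \<open>Beyond \<open>R\<close> both entropies have small tails; on \<open>{-R..R}\<close> the
  densities are uniformly close and \<open>entropy_fun\<close> is uniformly continuous. No estimate
  involves \<open>c\<close>, so \<open>S\<close> serves all offsets.\<close>

lemma entropy_binned_density_converges:
  assumes "0 < \<epsilon>"
  obtains S where "1 \<le> S"
    "\<And>s c. S \<le> s \<Longrightarrow>
      \<bar>(LBINT x. entropy_fun (binned_density s c x)) - (LBINT x. entropy_fun (p x))\<bar> \<le> \<epsilon>"
proof -
  have "eventually (\<lambda>n. tail_bound (real n) < \<epsilon> / 4) sequentially"
    using tail_bound_tendsto_0 assms by (intro order_tendstoD) auto
  then have "eventually (\<lambda>n. tail_bound (real n) < \<epsilon> / 4 \<and> 1 \<le> n) sequentially"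
    using eventually_ge_at_top by eventually_elim auto
  then obtain n :: nat where "tail_bound (real n) < \<epsilon> / 4" "1 \<le> n"
    by (auto simp: eventually_sequentially)
  then obtain R :: real where R: "tail_bound R < \<epsilon> / 4" "1 \<le> R"
    by (intro that[of "real n"]) auto
  \<comment> \<open>The interval of length \<open>2 * R\<close> then contributes
    \<open>\<epsilon> / 2\<close>, and each of the two tails at most
    \<open>\<epsilon> / 4\<close>.\<close>
  define e where "e = \<epsilon> / (4 * R)"
  have e: "0 < e" using assms R by (simp add: e_def)
  have "uniformly_continuous_on {0..B} entropy_fun"
    by (intro compact_uniformly_continuous continuous_on_entropy_fun) simp
  then obtain d where d: "0 < d"
    "\<And>u v. u \<in> {0..B} \<Longrightarrow> v \<in> {0..B} \<Longrightarrow> \<bar>u - v\<bar> < d \<Longrightarrow> \<bar>entropy_fun u - entropy_fun v\<bar> < e"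
    using e unfolding uniformly_continuous_on_def dist_real_def by metis
  show ?thesis
  \<comment> \<open>\<open>K / d + 1\<close> ensures \<open>K / s < d\<close>, and the maximum with
    1 meets the hypothesis of the tail bound for binned densities.\<close>
  proof (rule that[of "max 1 (K / d + 1)"])
    fix s c assume "max 1 (K / d + 1) \<le> s"
    then have s: "1 \<le> s" "K / d < s" by auto
    then have s0: "0 < s" by simp
    let ?q = "binned_density s c"
    let ?T = "{x::real. R < \<bar>x\<bar>}"
    have "K / s < d" using s s0 d by (simp add: field_simps)
    then have close: "\<bar>entropy_fun (?q x) - entropy_fun (p x)\<bar> < e" for x
      using abs_binned_density_diff_le[OF s0, of c x] binned_density_le[OF s0, of c x]
        binned_density_nonneg[of s c x] p_nonneg[of x] p_le[of x] s0
      by (intro d(2)) auto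
    note iq = integrable_entropy_binned[OF s(1), of c] and ip = integrable_entropy_density
    have tq: "integrable lborel (\<lambda>x. indicator ?T x * \<bar>entropy_fun (?q x)\<bar>)"
      and tp: "integrable lborel (\<lambda>x. indicator ?T x * \<bar>entropy_fun (p x)\<bar>)"
      by (intro integrable_indicator_mult integrable_abs iq ip; simp)+
    have ib: "integrable lborel (\<lambda>x. indicator {-R..R} x * e)"
      by (auto simp: integrable_real_indicator emeasure_lborel_Icc_eq)
    have "\<bar>(LBINT x. entropy_fun (?q x)) - (LBINT x. entropy_fun (p x))\<bar>
      = \<bar>LBINT x. entropy_fun (?q x) - entropy_fun (p x)\<bar>"
      by (simp add: Bochner_Integration.integral_diff[OF iq ip])
    also have "\<dots> \<le> (LBINT x. \<bar>entropy_fun (?q x) - entropy_fun (p x)\<bar>)"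
      by (rule integral_abs_bound)
    also have "\<dots> \<le> (LBINT x. indicator {-R..R} x * e
        + (indicator ?T x * \<bar>entropy_fun (?q x)\<bar> + indicator ?T x * \<bar>entropy_fun (p x)\<bar>))"
    proof (rule integral_mono)
      fix x
      show "\<bar>entropy_fun (?q x) - entropy_fun (p x)\<bar> \<le> indicator {-R..R} x * e
        + (indicator ?T x * \<bar>entropy_fun (?q x)\<bar> + indicator ?T x * \<bar>entropy_fun (p x)\<bar>)"
        using close[of x] e by (cases "R < \<bar>x\<bar>") (auto simp: indicator_def)
    qed (intro integrable_abs Bochner_Integration.integrable_diff Bochner_Integration.integrable_add iq ip tq tp ib)+
    also have "\<dots> = 2 * R * e + ((LBINT x. indicator ?T x * \<bar>entropy_fun (?q x)\<bar>)
        + (LBINT x. indicator ?T x * \<bar>entropy_fun (p x)\<bar>))"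
      using R by (simp add: Bochner_Integration.integral_add[OF ib Bochner_Integration.integrable_add[OF tq tp]]
          Bochner_Integration.integral_add[OF tq tp])
    also have "\<dots> \<le> 2 * R * e + (\<epsilon> / 4 + \<epsilon> / 4)"
      using entropy_binned_tail[OF s(1), of R c] entropy_density_tail[of R] R by simp
    also have "\<dots> = \<epsilon>" using R by (simp add: e_def)
    finally show "\<bar>(LBINT x. entropy_fun (?q x)) - (LBINT x. entropy_fun (p x))\<bar> \<le> \<epsilon>" .
  qed simp
qed

text \<open>For a cell of mass \<open>N\<close>,
  \<open>- N * ln N = N * ln s - N * ln (s * N)\<close>. In the sum over cells the masses add up to
  1, and the factor \<open>1 / s\<close> in \<open>N = (1 / s) * (s * N)\<close> is the length of a
  cell.\<close>

lemma
  assumes s: "1 \<le> s"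
  shows integrable_entropy_bins:
      "integrable (count_space UNIV) (\<lambda>k. entropy_fun (measure M {x. bin s c x = k}))"
    and entropy_bins_eq:
      "(\<integral>k. entropy_fun (measure M {x. bin s c x = k}) \<partial>count_space UNIV)
        = ln s + (LBINT x. entropy_fun (binned_density s c x))"
proof -
  have s0: "0 < s" using s by simp
  let ?N = "\<lambda>k. measure M {x. bin s c x = k}"
  let ?E = "\<lambda>k. entropy_fun (s * ?N k)"
  have iN: "integrable (count_space UNIV) ?N"
    using integrable_bin[of "\<lambda>_. 1" s c] by simp
  have "integrable lborel (\<lambda>x. ?E (bin s c x))"
    using integrable_entropy_binned[OF s, of c] by (simp add: binned_density_def)
  then have iE: "integrable (count_space UNIV) ?E"
    by (rule iffD1[OF integrable_lborel_bin[OF s0, of ?E c]])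
  have eq: "entropy_fun (?N k) = ln s * ?N k + (1 / s) * ?E k" for k
  proof (cases "?N k = 0")
    case False
    then have "0 < ?N k" using measure_nonneg[of M "{x. bin s c x = k}"] by linarith
    then have "ln (s * ?N k) = ln s + ln (?N k)" using s0 by (intro ln_mult_pos)
    then show ?thesis using s0 by (simp add: entropy_fun_def field_simps)
  qed (simp add: entropy_fun_def)
  show "integrable (count_space UNIV) (\<lambda>k. entropy_fun (?N k))"
    unfolding eq by (intro Bochner_Integration.integrable_add integrable_mult_right iN iE)
  have "(\<integral>k. entropy_fun (?N k) \<partial>count_space UNIV)
     = (\<integral>k. ln s * ?N k \<partial>count_space UNIV) + (\<integral>k. (1 / s) * ?E k \<partial>count_space UNIV)"
    unfolding eq by (intro Bochner_Integration.integral_add integrable_mult_right iN iE)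
  also have "(\<integral>k. ln s * ?N k \<partial>count_space UNIV) = ln s"
    using integral_bin[of "\<lambda>_. 1" s c] prob_space by simp
  also have "(\<integral>k. (1 / s) * ?E k \<partial>count_space UNIV) = (LBINT x. ?E (bin s c x))"
    using integral_lborel_bin[OF s0, of ?E c] by simp
  finally show "(\<integral>k. entropy_fun (?N k) \<partial>count_space UNIV)
        = ln s + (LBINT x. entropy_fun (binned_density s c x))"
    by (simp add: binned_density_def)
qed

text \<open>The Radon-Nikodym derivative agrees with \<open>p\<close> almost everywhere, which is
  enough under the integral.\<close>

lemma diff_entropy_eq: "diff_entropy M = (LBINT x. entropy_fun (p x))"
proof -
  have "AE x in lborel. ennreal (p x) = RN_deriv lborel M x"
    by (rule sigma_finite_measure.RN_deriv_unique[OF sigma_finite_lborel]) (auto simp: M_eq)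
  then have "AE x in lborel. enn2real (RN_deriv lborel M x) = p x"
    by eventually_elim (metis enn2real_ennreal p_nonneg)
  then have "(LBINT x. enn2real (RN_deriv lborel M x) * ln (enn2real (RN_deriv lborel M x)))
      = (LBINT x. p x * ln (p x))"
    by (intro integral_cong_AE) (auto elim!: eventually_mono)
  then show ?thesis by (simp add: diff_entropy_def entropy_fun_def)
qed

end

section \<open>Quantised stable increments\<close>

lemma (in real_distribution) char_distr_affine:
  "char (distr M borel (\<lambda>x. a * x + b)) \<omega> = iexp (\<omega> * b) * char M (a * \<omega>)"
proof -
  have "char (distr M borel (\<lambda>x. a * x + b)) \<omega> = (CLINT x|M. iexp (\<omega> * (a * x + b)))"
    unfolding char_def by (subst integral_distr) auto
  also have "\<dots> = (CLINT x|M. iexp (\<omega> * b) * iexp (a * \<omega> * x))"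
    by (intro Bochner_Integration.integral_cong) (auto simp: algebra_simps simp flip: exp_add)
  finally show ?thesis by (simp add: char_def)
qed

text \<open>The decay of \<open>cmod (char M t)\<close> yields the density with its bound and
  Lipschitz constant; the Hoelder bound on \<open>1 - Re (char M t)\<close> yields the logarithmic
  moment.\<close>

lemma (in real_distribution) stable_lipschitz_density:
  assumes "0 < \<alpha>" "0 < \<sigma>"
    and char_eq: "\<And>\<omega>. char M \<omega> = exp (stable_exponent \<alpha> \<beta> \<sigma> \<mu> \<omega>)"
  shows "lipschitz_density M (fourier_density M) (max 1 (LBINT t. cmod (char M t)))
    (LBINT t. \<bar>t\<bar> * cmod (char M t))"
proof -
  have c: "0 < \<sigma> powr \<alpha>" using \<open>0 < \<sigma>\<close> by simp
  have norm: "cmod (char M t) = exp (- (\<sigma> powr \<alpha> * \<bar>t\<bar> powr \<alpha>))" for t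
    by (simp add: char_eq Re_stable_exponent)
  note int = integrable_max_exp_neg_powr[OF \<open>0 < \<alpha>\<close> c]
  have i1: "integrable lborel (char M)"
  proof (rule Bochner_Integration.integrable_bound[OF int])
    show "AE t in lborel. cmod (char M t) \<le> norm (max 1 \<bar>t\<bar> * exp (- (\<sigma> powr \<alpha> * \<bar>t\<bar> powr \<alpha>)))"
      unfolding norm by (auto simp: mult_le_cancel_right1)
  qed simp
  have i2: "integrable lborel (\<lambda>t. \<bar>t\<bar> * cmod (char M t))"
  proof (rule Bochner_Integration.integrable_bound[OF int])
    show "AE t in lborel. norm (\<bar>t\<bar> * cmod (char M t)) \<le> norm (max 1 \<bar>t\<bar> * exp (- (\<sigma> powr \<alpha> * \<bar>t\<bar> powr \<alpha>)))"
      unfolding norm by (auto intro!: mult_right_mono)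
  qed simp
  show ?thesis
  proof
    show "fourier_density M \<in> borel_measurable borel" by (rule fourier_density_measurable[OF i1])
    show "M = density lborel (fourier_density M)" by (rule eq_density_fourier_density[OF i1 i2])
    show "integrable M (\<lambda>x. ln (1 + x\<^sup>2))"
      using one_minus_Re_exp_stable_exponent_le[OF \<open>0 < \<alpha>\<close>, of \<beta> \<sigma> \<mu>, folded char_eq]
      by (rule integrable_ln_one_plus_square) (use \<open>0 < \<alpha>\<close> in auto)
    fix x y
    show "0 \<le> fourier_density M x" by (rule fourier_density_nonneg[OF i1 i2])
    show "fourier_density M x \<le> max 1 (LBINT t. cmod (char M t))"
      using fourier_density_bound[OF i1, of x] by linarith
    show "\<bar>fourier_density M x - fourier_density M y\<bar> \<le> (LBINT t. \<bar>t\<bar> * cmod (char M t)) * \<bar>x - y\<bar>"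
      by (rule fourier_density_lipschitz[OF i1 i2])
  qed simp
qed

text \<open>Since \<open>1/2 + m * (a * x + b) = (1/2 + m * b) + (m * a) * x\<close>, quantising the
  affine image is binning with \<open>s = m * a\<close>; the rounding offset and the shift
  \<open>b\<close> enter only through the offset of the grid.\<close>

lemma (in lipschitz_density) quant_entropy_affine:
  assumes "0 < m" "1 \<le> real m * a"
  shows "quant_entropy (distr M borel (\<lambda>x. a * x + b)) m
    = ereal (ln (real m * a) + (LBINT x. entropy_fun (binned_density (real m * a) (1 / 2 + real m * b) x)))"
proof -
  let ?Q = "distr M borel (\<lambda>x. a * x + b)"
  let ?s = "real m * a" and ?c = "1 / 2 + real m * b"
  let ?N = "\<lambda>k. measure M {x. bin ?s ?c x = k}"
  let ?g = "\<lambda>k::int. real_of_int k / real m"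
  let ?f = "\<lambda>v. ennreal (let p = measure ?Q {x \<in> space ?Q. quant m x = v} in - p * ln p)"
  have "quant m ` UNIV = range ?g"
  proof (intro set_eqI iffI)
    fix v assume "v \<in> range ?g"
    then obtain k where v: "v = ?g k" by auto
    have "quant m (?g k) = ?g k" using \<open>0 < m\<close> by (simp add: quant_def quant_index_def floor_eq_iff)
    then show "v \<in> quant m ` UNIV" unfolding v by (metis rangeI)
  qed (auto simp: quant_def)
  moreover have "inj ?g" using \<open>0 < m\<close> by (auto intro!: injI)
  \<comment> \<open>The values of the quantiser are indexed by the integers, so the sum over values
    becomes one over cells.\<close>
  ultimately have "bij_betw ?g UNIV (quant m ` UNIV)" by (simp add: bij_betw_def)
  then have "(\<integral>\<^sup>+ v. ?f v \<partial>count_space (quant m ` UNIV)) = (\<integral>\<^sup>+ k. ?f (?g k) \<partial>count_space UNIV)"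
    by (rule nn_integral_bij_count_space[symmetric])
  also have "\<dots> = (\<integral>\<^sup>+ k. ennreal (entropy_fun (?N k)) \<partial>count_space UNIV)"
  proof (intro nn_integral_cong)
    fix k
    have "{x \<in> space ?Q. quant m x = ?g k} = {x. quant_index m x = k}"
      using \<open>0 < m\<close> by (simp add: quant_def)
    moreover have "{x. quant_index m x = k} \<in> sets borel"
      unfolding quant_index_def by measurable
    moreover have "quant_index m (a * x + b) = bin ?s ?c x" for x
      by (simp add: quant_index_def bin_def algebra_simps)
    ultimately have "measure ?Q {x \<in> space ?Q. quant m x = ?g k} = ?N k"
      by (simp add: measure_distr vimage_def)
    then show "?f (?g k) = ennreal (entropy_fun (?N k))" by (simp add: Let_def entropy_fun_def)
  qed
  \<comment> \<open>Cell masses are at most 1, so all terms are nonnegative and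
    \<open>ennreal\<close> truncates nothing.\<close>
  also have "\<dots> = ennreal (\<integral>k. entropy_fun (?N k) \<partial>count_space UNIV)"
    by (rule nn_integral_eq_integral[OF integrable_entropy_bins[OF assms(2)]])
      (intro AE_I2 entropy_fun_nonneg measure_nonneg prob_le_1)
  finally have "quant_entropy ?Q m = enn2ereal (ennreal (\<integral>k. entropy_fun (?N k) \<partial>count_space UNIV))"
    by (simp only: quant_entropy_def)
  also have "\<dots> = ereal (\<integral>k. entropy_fun (?N k) \<partial>count_space UNIV)"
    by (intro enn2ereal_ennreal integral_nonneg_AE AE_I2 entropy_fun_nonneg measure_nonneg prob_le_1)
  finally show ?thesis by (simp only: entropy_bins_eq[OF assms(2)])
qed

text \<open>\<open>P n\<close> is the law of the increment over an interval of length
  \<open>1/n\<close>: evaluating the characteristic functional at \<open>\<omega>\<close> times its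
  indicator gives the exponent divided by \<open>n\<close>, and \<open>P 1\<close> is the law of the
  increment over \<open>[0, 1]\<close>. One \<epsilon> for all \<open>m \<ge> mf n\<close> expresses
  convergence of the supremum.\<close>

theorem mainTheorem3:
  fixes \<alpha> \<beta> \<sigma> \<mu> :: real
    and P :: "nat \<Rightarrow> real measure"
    and mf :: "nat \<Rightarrow> nat"
  assumes "0 < \<alpha>" "\<alpha> \<le> 2" "-1 \<le> \<beta>" "\<beta> \<le> 1" "0 < \<sigma>"
    and P_distr: "\<And>n. n \<ge> 1 \<Longrightarrow> real_distribution (P n)"
    and P_char: "\<And>n \<omega>. n \<ge> 1 \<Longrightarrow>
        char (P n) \<omega> = exp (complex_of_real (1 / real n) * stable_exponent \<alpha> \<beta> \<sigma> \<mu> \<omega>)"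
    and mf_lim: "filterlim (\<lambda>n. real (mf n) / real n powr (1 / \<alpha>)) at_top sequentially"
  shows "\<forall>\<epsilon>>0. \<forall>\<^sub>F n in sequentially. \<forall>m \<ge> mf n.
           \<bar>H_mn (P n) m n / ereal (real n)
             - ereal (ln (real m / real n powr (1 / \<alpha>)))
             - ereal (diff_entropy (P 1))\<bar> \<le> ereal \<epsilon>"
proof (intro allI impI)
  fix \<epsilon> :: real assume \<epsilon>: "0 < \<epsilon>"
  interpret M: real_distribution "P 1" by (rule P_distr) simp
  have char1: "char (P 1) \<omega> = exp (stable_exponent \<alpha> \<beta> \<sigma> \<mu> \<omega>)" for \<omega>
    using P_char[of 1] by simp
  interpret M: lipschitz_density "P 1" "fourier_density (P 1)"
      "max 1 (LBINT t. cmod (char (P 1) t))" "LBINT t. \<bar>t\<bar> * cmod (char (P 1) t)"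
    by (rule M.stable_lipschitz_density[OF \<open>0 < \<alpha>\<close> \<open>0 < \<sigma>\<close> char1])
  \<comment> \<open>\<open>S\<close> depends on \<open>\<epsilon>\<close> alone, not on
    \<open>n\<close>, \<open>m\<close> or the grid offset; the uniformity in \<open>m\<close> rests
    on this.\<close>
  obtain S where S: "1 \<le> S" "\<And>s c. S \<le> s \<Longrightarrow>
      \<bar>(LBINT x. entropy_fun (M.binned_density s c x)) - (LBINT x. entropy_fun (fourier_density (P 1) x))\<bar> \<le> \<epsilon>"
    using M.entropy_binned_density_converges[OF \<epsilon>] by metis
  have "eventually (\<lambda>n. S \<le> real (mf n) / real n powr (1 / \<alpha>)) sequentially"
    using mf_lim by (simp add: filterlim_at_top)
  then show "\<forall>\<^sub>F n in sequentially. \<forall>m \<ge> mf n.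
           \<bar>H_mn (P n) m n / ereal (real n)
             - ereal (ln (real m / real n powr (1 / \<alpha>)))
             - ereal (diff_entropy (P 1))\<bar> \<le> ereal \<epsilon>"
    using eventually_ge_at_top[of 1]
  proof eventually_elim
    case (elim n)
    have n: "1 \<le> n" by fact
    \<comment> \<open>Chosen so that \<open>a powr \<alpha> = 1 / n\<close>, the factor in the
      exponent of \<open>P n\<close>.\<close>
    define a where "a = real n powr (- (1 / \<alpha>))"
    have a: "0 < a" using n by (simp add: a_def)
    have a_powr: "a powr \<alpha> = 1 / real n"
      using n \<open>0 < \<alpha>\<close> unfolding a_def powr_powr by (simp add: powr_minus_divide)
    obtain b where b: "\<And>\<omega>. complex_of_real (a powr \<alpha>) * stable_exponent \<alpha> \<beta> \<sigma> \<mu> \<omega>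
      = \<i> * complex_of_real (\<omega> * b) + stable_exponent \<alpha> \<beta> \<sigma> \<mu> (a * \<omega>)"
      using stable_exponent_rescale[OF a] by metis
    have Pn: "P n = distr (P 1) borel (\<lambda>x. a * x + b)"
    proof (rule Levy_uniqueness[OF P_distr[OF n]])
      show "real_distribution (distr (P 1) borel (\<lambda>x. a * x + b))"
        by (rule M.real_distribution_distr) measurable
      show "char (P n) = char (distr (P 1) borel (\<lambda>x. a * x + b))"
        unfolding M.char_distr_affine char1
        by (rule ext) (simp only: P_char[OF n] b[unfolded a_powr] exp_add M.char_distr_affine char1)
    qed
    show ?case
    proof (intro allI impI)
      fix m assume "mf n \<le> m"
      let ?s = "real m * a"
      have s_eq: "real m / real n powr (1 / \<alpha>) = ?s"
        by (simp add: a_def powr_minus_divide)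
      have "real (mf n) / real n powr (1 / \<alpha>) \<le> real m / real n powr (1 / \<alpha>)"
        using \<open>mf n \<le> m\<close> by (intro divide_right_mono) auto
      with elim have s: "S \<le> ?s" unfolding s_eq by linarith
      then have s1: "1 \<le> ?s" using S(1) by linarith
      then have m: "0 < m" by (cases "m = 0") auto
      let ?h = "LBINT x. entropy_fun (M.binned_density ?s (1 / 2 + real m * b) x)"
      have "H_mn (P n) m n / ereal (real n) = quant_entropy (P n) m"
        using n unfolding H_mn_def Pn M.quant_entropy_affine[OF m s1] by simp
      also have "\<dots> = ereal (ln ?s + ?h)"
        unfolding Pn by (rule M.quant_entropy_affine[OF m s1])
      \<comment> \<open>The two terms \<open>ln ?s\<close> cancel, which leaves the difference
        between the entropies of the binned and the original density.\<close>
      finally have "\<bar>H_mn (P n) m n / ereal (real n) - ereal (ln (real m / real n powr (1 / \<alpha>)))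
             - ereal (diff_entropy (P 1))\<bar> = ereal \<bar>?h - (LBINT x. entropy_fun (fourier_density (P 1) x))\<bar>"
        unfolding s_eq M.diff_entropy_eq by simp
      also have "\<dots> \<le> ereal \<epsilon>"
        using S(2)[OF s] by simp
      finally show "\<bar>H_mn (P n) m n / ereal (real n) - ereal (ln (real m / real n powr (1 / \<alpha>)))
             - ereal (diff_entropy (P 1))\<bar> \<le> ereal \<epsilon>" .
    qed
  qed
qed

end
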